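(* There exists a constant $\delta>0$ such that, for all sufficiently large positive integers $N$, $$\#\{n\le N : n=m+a^a \text{ for some } m\in\mathcal{P}_2 \text{ and some integer } a\ge 1\}\ \ge\ \delta N .$$
   Context: $\Omega(m)$ denotes the number of prime factors of the positive integer $m$, counted with multiplicity, with $\Omega(1)=0$. $\mathcal{P}_2=\{m\ge 1 : \Omega(m)\le 2\}$ (so $1$, all primes, and all products of two primes belong to $\mathcal{P}_2$). Here $n$ ranges over positive integers. *)

theory Defs
  imports Complex_Main "HOL-Computational_Algebra.Primes"
begin

definition big_omega :: "nat \<Rightarrow> nat" where
  "big_omega m = size (prime_factorization m)"

(* The condition m \<ge> 1 is essential: prime_factorization 0 is the empty multiset. *)
definition P2 :: "nat set" where
  "P2 = {m. m \<ge> 1 \<and> big_omega m \<le> 2}"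

end

theory Submission
  imports Defs "HOL-Number_Theory.Number_Theory" "HOL-Analysis.Harmonic_Numbers"
begin

text \<open>
  Romanoff's second moment method. Let \<open>z\<close> be about \<open>N\<close> to the power \<open>1/8\<close> and count triples
  \<open>(p, q, a)\<close> with primes \<open>p \<le> z < q\<close>, \<open>p q \<le> N/2\<close> and \<open>a \<le> A\<close>, where \<open>A\<close> is maximal with
  \<open>A ^ A \<le> N/2\<close>. With \<open>L\<close> the sum of \<open>1/p\<close> over \<open>p \<le> z\<close>, Chebyshev's lower bound gives
  \<open>\<gg> A L N / ln N\<close> triples, which is \<open>\<gg> N\<close> because \<open>L \<gg> ln ln N\<close>. By Cauchy-Schwarz it remains
  to bound the number of coincidences \<open>p q + a ^ a = p' q' + b ^ b\<close> by \<open>O(N (A L / ln N)^2)\<close>.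

  For fixed \<open>p, p'\<close> and \<open>a < b\<close>, an upper bound sieve of dimension two bounds the pairs \<open>(q, q')\<close> by
  \<open>O(N / (p p' (ln N)^2))\<close> times the product of \<open>(1 + 1/(r - 1))^2\<close> over the primes \<open>r\<close> dividing
  \<open>b ^ b - a ^ a\<close>. That product is bounded on average over \<open>a, b\<close>, since a congruence
  \<open>b ^ b \<equiv> c\<close> modulo a small prime \<open>r\<close> holds for a proportion of only \<open>O(1 / sqrt r)\<close> of all \<open>b\<close>.
\<close>

section \<open>An orthogonality sieve\<close>

text \<open>Primes alone would not suffice: there are about ln N / ln ln N self-powers up to
  \<open>N\<close>, so sums of a prime and a self-power have only about N / ln ln N representations.
  The small prime factor supplies the missing ln ln N. Keeping it below \<open>z\<close> and the
  other factor above \<open>z\<close> makes the pair recoverable from the product and leaves the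
  sieve an interval of length at least N / z^2.

  The delicate point is the average of the product over primes \<open>r\<close>. The residue of
  \<open>b ^ b\<close> modulo \<open>r\<close> has period r (r - 1), so equidistribution is
  available only for \<open>r\<close> up to about sqrt A. Larger primes are handled pointwise: b^b -
  a^a is at most 2^(A^2), so its prime factors beyond A^2 contribute a bounded factor, and the
  primes between sqrt A and A^2 have a bounded sum of reciprocals. For small \<open>r\<close>, the 1
  / r of the local factor, the saving 1 / sqrt r and a loss of r^(1/4) from a crude bound for the
  product over smaller primes combine to r^(-5/4), which is summable.\<close>

lemma sum_mult_coprime_periodic:
  fixes f g :: "nat \<Rightarrow> real"
  assumes "coprime m n" "m > 0" "n > 0"
    and f: "\<And>x. f (x mod m) = f x" and g: "\<And>x. g (x mod n) = g x"
  shows "(\<Sum>x<m * n. f x * g x) = (\<Sum>x<m. f x) * (\<Sum>x<n. g x)"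
proof -
  let ?h = "\<lambda>x. (x mod m, x mod n)"
  have inj: "inj_on ?h {..<m * n}"
  proof (rule inj_onI)
    fix x y assume xy: "x \<in> {..<m * n}" "y \<in> {..<m * n}" "?h x = ?h y"
    then have "[x = y] (mod m)" "[x = y] (mod n)" by (auto simp: cong_def)
    then have "[x = y] (mod (m * n))"
      using assms(1) by (simp add: coprime_cong_mult_nat)
    then show "x = y" using xy by (simp add: cong_less_modulus_unique_nat)
  qed
  \<comment> \<open>Chinese remainder theorem: surjectivity follows from injectivity, since both
    sides have \<open>m * n\<close> elements.\<close>
  have "bij_betw ?h {..<m * n} ({..<m} \<times> {..<n})"
    unfolding bij_betw_def
  proof
    show "?h ` {..<m * n} = {..<m} \<times> {..<n}"
      using assms by (intro card_subset_eq) (auto simp: card_image[OF inj])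
  qed (rule inj)
  then have "(\<Sum>x<m * n. (\<lambda>(a, b). f a * g b) (?h x)) = (\<Sum>(a, b)\<in>{..<m} \<times> {..<n}. f a * g b)"
    by (rule sum.reindex_bij_betw)
  then show ?thesis by (simp add: f g sum_product sum.cartesian_product)
qed

lemma prod_periodic:
  fixes f :: "nat \<Rightarrow> nat \<Rightarrow> real"
  assumes "finite C" "\<And>p x. p \<in> C \<Longrightarrow> f p (x mod p) = f p x"
  shows "(\<Prod>p\<in>C. f p (x mod \<Prod>C)) = (\<Prod>p\<in>C. f p x)"
proof (rule prod.cong)
  fix p assume "p \<in> C"
  then have "p dvd \<Prod>C" using assms(1) by (auto intro: dvd_prodI)
  then show "f p (x mod \<Prod>C) = f p x" using assms(2)[OF \<open>p \<in> C\<close>] by (metis mod_mod_cancel)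
qed simp

lemma sum_prod_periodic_primes:
  fixes f :: "nat \<Rightarrow> nat \<Rightarrow> real"
  assumes "finite C" "\<And>p. p \<in> C \<Longrightarrow> prime p" "\<And>p x. p \<in> C \<Longrightarrow> f p (x mod p) = f p x"
  shows "(\<Sum>x<\<Prod>C. \<Prod>p\<in>C. f p x) = (\<Prod>p\<in>C. \<Sum>x<p. f p x)"
  using assms
proof (induction C rule: finite_induct)
  case (insert q C)
  have "coprime q (\<Prod>C)"
    using insert by (intro prod_coprime_right primes_coprime) auto
  moreover have "\<Prod>C > 0" using insert.prems insert.hyps by (intro prod_pos) (auto intro: prime_gt_0_nat)
  moreover have "(\<Prod>p\<in>C. f p (x mod \<Prod>C)) = (\<Prod>p\<in>C. f p x)" for x
    using insert.hyps insert.prems by (intro prod_periodic) auto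
  ultimately have "(\<Sum>x<q * \<Prod>C. f q x * (\<Prod>p\<in>C. f p x)) = (\<Sum>x<q. f q x) * (\<Sum>x<\<Prod>C. \<Prod>p\<in>C. f p x)"
    using insert.prems by (intro sum_mult_coprime_periodic) (auto intro: prime_gt_0_nat)
  then show ?case using insert by simp
qed simp

text \<open>Full periods contribute exactly, the incomplete last one at most \<open>D * B\<close>.
  Nonnegativity of the sum over one period is what allows \<open>X div D\<close> to be replaced by
  \<open>X / D\<close>.\<close>

lemma sum_periodic_le:
  fixes f :: "nat \<Rightarrow> real"
  assumes "D > 0" and per: "\<And>x. f (x mod D) = f x" and bound: "\<And>x. f x \<le> B"
    and "B \<ge> 0" and S: "(\<Sum>x<D. f x) \<ge> 0"
  shows "(\<Sum>x<X. f x) \<le> real X / real D * (\<Sum>x<D. f x) + real D * B"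
proof -
  define q r where "q = X div D" and "r = X mod D"
  have X: "X = q * D + r" and r: "r < D" using assms(1) by (auto simp: q_def r_def)
  have sh: "f (m * D + i) = f i" for m i
    using per[of "m * D + i"] per[of i] by simp
  have "(\<Sum>x<q * D. f x) = (\<Sum>m<q. sum f {m * D..<m * D + D})"
    by (rule sum.nat_group[symmetric])
  also have "\<dots> = (\<Sum>m<q. \<Sum>x<D. f x)"
  proof (rule sum.cong)
    fix m
    have "sum f {m * D..<m * D + D} = sum f {0 + m * D..<D + m * D}" by (simp add: add.commute)
    also have "\<dots> = (\<Sum>x=0..<D. f (x + m * D))" by (rule sum.shift_bounds_nat_ivl)
    also have "\<dots> = (\<Sum>x<D. f x)" using sh by (simp add: atLeast0LessThan add.commute)
    finally show "sum f {m * D..<m * D + D} = (\<Sum>x<D. f x)" .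
  qed simp
  finally have 1: "(\<Sum>x<q * D. f x) = real q * (\<Sum>x<D. f x)" by simp
  have "(\<Sum>x<X. f x) = (\<Sum>x<q * D. f x) + (\<Sum>x=q*D..<X. f x)"
    unfolding X by (metis lessThan_atLeast0 sum.atLeastLessThan_concat le_add1 zero_le)
  also have "(\<Sum>x=q*D..<X. f x) \<le> (\<Sum>x=q*D..<X. B)" by (intro sum_mono bound)
  also have "\<dots> = real r * B" by (simp add: X)
  also have "\<dots> \<le> real D * B" using r assms by (intro mult_right_mono) auto
  finally have "(\<Sum>x<X. f x) \<le> real q * (\<Sum>x<D. f x) + real D * B" using 1 by linarith
  moreover have "real q \<le> real X / real D"
    using assms(1) X by (simp add: field_simps flip: of_nat_mult)
  ultimately show ?thesis using mult_right_mono[OF _ S, of "real q" "real X / real D"] by linarith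
qed

text \<open>A set of primes stands for the squarefree integer that is its product, so sums over
  squarefree integers up to \<open>z\<close> become sums over sets, with union and intersection in
  place of lcm and gcd.\<close>

definition bounded_subsets :: "nat set \<Rightarrow> nat \<Rightarrow> nat set set" where
  "bounded_subsets Q z = {A. A \<subseteq> Q \<and> \<Prod>A \<le> z}"

lemma finite_bounded_subsets [simp]: "finite Q \<Longrightarrow> finite (bounded_subsets Q z)"
  unfolding bounded_subsets_def by (rule finite_subset[of _ "Pow Q"]) auto

text \<open>By unique factorization a set of primes is recovered from its product.\<close>

lemma card_bounded_subsets_le:
  assumes "finite Q" "\<And>p. p \<in> Q \<Longrightarrow> prime p"
  shows "card (bounded_subsets Q z) \<le> z"
proof -
  have *: "prime_factors (\<Prod>A) = A" if "A \<in> bounded_subsets Q z" for A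
  proof -
    have A: "finite A" "\<And>p. p \<in> A \<Longrightarrow> prime p"
      using that assms by (auto simp: bounded_subsets_def intro: finite_subset)
    then have "prime_factors (\<Prod>A) = (\<Union>p\<in>A. prime_factors p)"
      by (subst prime_factors_prod) (auto dest: prime_gt_0_nat)
    then show ?thesis using A by (simp add: prime_prime_factors)
  qed
  then have "inj_on Prod (bounded_subsets Q z)" by (metis (mono_tags, lifting) inj_onI)
  moreover have "Prod ` bounded_subsets Q z \<subseteq> {1..z}"
  proof (rule image_subsetI)
    fix A assume A: "A \<in> bounded_subsets Q z"
    then have "\<Prod>A > 0"
      using assms(2) by (intro prod_pos) (auto simp: bounded_subsets_def intro!: prime_gt_0_nat)
    then show "\<Prod>A \<in> {1..z}" using A by (simp add: bounded_subsets_def)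
  qed
  ultimately have "card (bounded_subsets Q z) \<le> card {1..z}" 
    by (intro card_inj_on_le) auto
  then show ?thesis by simp
qed

text \<open>An inequality of large sieve type with two classes removed modulo each prime; 2 / (p -
  2) is the ratio of removed to surviving classes. The error is crude: at most z^2 pairs of sets,
  each with a period of at most z^2 and a product of size at most z^2.\<close>

theorem orthogonality_sieve:
  fixes Q :: "nat set" and R :: "nat \<Rightarrow> nat set" and T :: "nat set"
  assumes Q: "finite Q" "\<And>p. p \<in> Q \<Longrightarrow> prime p" "\<And>p. p \<in> Q \<Longrightarrow> p > 2"
    and R: "\<And>p. p \<in> Q \<Longrightarrow> R p \<subseteq> {..<p}" "\<And>p. p \<in> Q \<Longrightarrow> card (R p) = 2"
    and T: "T \<subseteq> {..<X}" "\<And>t p. t \<in> T \<Longrightarrow> p \<in> Q \<Longrightarrow> t mod p \<notin> R p"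
    and "z \<ge> 1"
  shows "real (card T) * (\<Sum>A\<in>bounded_subsets Q z. \<Prod>p\<in>A. 2 / (real p - 2)) \<le> real X + real z ^ 6"
proof -
  let ?D = "bounded_subsets Q z"
  define \<psi> where "\<psi> p x = (if x mod p \<in> R p then -1 else 2 / (real p - 2))" for p x
  \<comment> \<open>\<open>\<psi> p\<close> has mean zero modulo \<open>p\<close>, so the products \<open>W A\<close> are nearly orthogonal on \<open>{..<X}\<close>, while
    all of them are constant on \<open>T\<close>. Expanding the square of \<open>\<Sum>A. W A x\<close> bounds \<open>card T\<close>.\<close>
  define W where "W A x = (\<Prod>p\<in>A. \<psi> p x)" for A x
  define c where "c A = (\<Prod>p\<in>A. 2 / (real p - 2))" for A
  define G where "G = (\<Sum>A\<in>?D. c A)"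
  have fin: "finite A" if "A \<in> ?D" for A
    using that Q(1) by (auto simp: bounded_subsets_def intro: finite_subset)
  have DQ: "p \<in> Q" if "A \<in> ?D" "p \<in> A" for A p
    using that by (auto simp: bounded_subsets_def)
  have per: "\<psi> p (x mod p) = \<psi> p x" for p x by (simp add: \<psi>_def)
  have c_nonneg: "c A \<ge> 0" if "A \<in> ?D" for A
    unfolding c_def by (intro prod_nonneg) (use Q(3) DQ[OF that] in \<open>force\<close>)
  have split: "(\<Sum>x<p. F (\<psi> p x)) = 2 * F (-1) + (real p - 2) * F (2 / (real p - 2))"
    if p: "p \<in> Q" for p and F :: "real \<Rightarrow> real"
  proof -
    have "(\<Sum>x<p. F (\<psi> p x)) = (\<Sum>x\<in>R p. F (\<psi> p x)) + (\<Sum>x\<in>{..<p} - R p. F (\<psi> p x))"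
      using R(1)[OF p] by (metis add.commute finite_lessThan sum.subset_diff)
    also have "(\<Sum>x\<in>R p. F (\<psi> p x)) = (\<Sum>x\<in>R p. F (-1))"
      using R(1)[OF p] by (intro sum.cong) (auto simp: \<psi>_def subset_iff)
    also have "(\<Sum>x\<in>{..<p} - R p. F (\<psi> p x)) = (\<Sum>x\<in>{..<p} - R p. F (2 / (real p - 2)))"
      by (intro sum.cong) (auto simp: \<psi>_def)
    also have "card ({..<p} - R p) = p - 2"
      using R[OF p] by (subst card_Diff_subset) (auto intro: finite_subset)
    then have "(\<Sum>x\<in>{..<p} - R p. F (2 / (real p - 2))) = (real p - 2) * F (2 / (real p - 2))"
      using Q(3)[OF p] by (simp add: of_nat_diff)
    finally show ?thesis using R(2)[OF p] by simp
  qed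
  have sum0: "(\<Sum>x<p. \<psi> p x) = 0" if "p \<in> Q" for p
    using split[OF that, of "\<lambda>x. x"] Q(3)[OF that] by (simp add: field_simps)
  have sum2: "(\<Sum>x<p. \<psi> p x * \<psi> p x) = real p * (2 / (real p - 2))" if "p \<in> Q" for p
  proof -
    define r where "r = real p - 2"
    have "r > 0" "real p = r + 2" using Q(3)[OF that] by (auto simp: r_def)
    then show ?thesis using split[OF that, of "\<lambda>x. x * x"] by (simp add: field_simps)
  qed
  have bnd: "\<bar>\<psi> p x\<bar> \<le> real p" if "p \<in> Q" for p x
  proof -
    have "2 / (real p - 2) \<le> 2" using Q(3)[OF that] by (simp add: field_simps)
    then show ?thesis using Q(3)[OF that] by (auto simp: \<psi>_def)
  qed
  have W_bnd: "\<bar>W A x\<bar> \<le> real z" if "A \<in> ?D" for A x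
  proof -
    have "\<bar>W A x\<bar> \<le> (\<Prod>p\<in>A. real p)"
      unfolding W_def abs_prod by (intro prod_mono) (use bnd DQ[OF that] in auto)
    also have "\<dots> = real (\<Prod>A)" by simp
    also have "\<dots> \<le> real z" using that by (simp add: bounded_subsets_def del: of_nat_prod)
    finally show ?thesis .
  qed
  have pair: "(\<Sum>x<X. W A x * W B x) \<le> (if A = B then real X * c A else 0) + real z ^ 4"
    if AB: "A \<in> ?D" "B \<in> ?D" for A B
  proof -
    define C where "C = A \<union> B"
    \<comment> \<open>A prime common to \<open>A\<close> and \<open>B\<close> contributes the square
      of \<open>\<psi> p\<close>, of mean 2 / (p - 2); a prime in only one of them contributes
      \<open>\<psi> p\<close> itself, whose zero mean kills the whole sum over a period.\<close>
    define f where "f p x = (if p \<in> A then \<psi> p x else 1) * (if p \<in> B then \<psi> p x else 1)" for p x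
    have C: "finite C" "\<And>p. p \<in> C \<Longrightarrow> p \<in> Q"
      using fin AB DQ by (auto simp: C_def)
    have WW: "W A x * W B x = (\<Prod>p\<in>C. f p x)" for x
    proof -
      have "W A x = (\<Prod>p\<in>C. if p \<in> A then \<psi> p x else 1)"
           "W B x = (\<Prod>p\<in>C. if p \<in> B then \<psi> p x else 1)"
        using C(1) by (auto simp: W_def C_def prod.inter_restrict[symmetric] Int_absorb1 Int_absorb2)
      then show ?thesis by (simp add: f_def prod.distrib)
    qed
    have fper: "f p (x mod p) = f p x" for p x by (simp add: f_def per)
    have pos: "\<Prod>C > 0" using C Q(2) by (intro prod_pos) (auto intro: prime_gt_0_nat)
    have S: "(\<Sum>x<\<Prod>C. W A x * W B x) = (\<Prod>p\<in>C. \<Sum>x<p. f p x)"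
      unfolding WW using C Q(2) fper by (intro sum_prod_periodic_primes) auto
    have S': "(\<Sum>x<\<Prod>C. W A x * W B x) = (if A = B then real (\<Prod>A) * c A else 0)"
    proof (cases "A = B")
      case True
      have "(\<Prod>p\<in>C. \<Sum>x<p. f p x) = (\<Prod>p\<in>A. real p * (2 / (real p - 2)))"
        using True DQ[OF AB(1)] by (intro prod.cong) (auto simp: C_def f_def sum2)
      then show ?thesis using True S by (simp add: c_def prod.distrib[symmetric])
    next
      case False
      then obtain p where p: "p \<in> C" "p \<notin> A \<or> p \<notin> B" by (auto simp: C_def)
      then have "(\<Sum>x<p. f p x) = (\<Sum>x<p. \<psi> p x)"
        by (intro sum.cong) (auto simp: f_def C_def)
      then have "(\<Prod>p\<in>C. \<Sum>x<p. f p x) = 0"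
        using p C sum0 by (metis prod_zero)
      then show ?thesis using False S by simp
    qed
    have Cz: "real (\<Prod>C) \<le> real z ^ 2"
    proof -
      have "\<Prod>C \<le> \<Prod>C * \<Prod>(A \<inter> B)"
        using fin[OF AB(1)] Q(2) DQ AB by (auto intro!: prod_pos simp: Suc_le_eq intro: prime_gt_0_nat)
      also have "\<dots> = \<Prod>A * \<Prod>B"
        unfolding C_def using fin AB by (intro prod.union_inter) auto
      also have "\<dots> \<le> z * z" using AB by (intro mult_mono) (auto simp: bounded_subsets_def)
      finally show ?thesis unfolding power2_eq_square by (metis of_nat_mono of_nat_mult)
    qed
    have "(\<Sum>x<X. W A x * W B x) \<le> real X / real (\<Prod>C) * (\<Sum>x<\<Prod>C. W A x * W B x) + real (\<Prod>C) * (real z ^ 2)"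
    proof (rule sum_periodic_le)
      show "W A (x mod \<Prod>C) * W B (x mod \<Prod>C) = W A x * W B x" for x
        unfolding WW by (rule prod_periodic) (use C fper in auto)
      show "W A x * W B x \<le> real z ^ 2" for x
      proof -
        have "W A x * W B x \<le> \<bar>W A x\<bar> * \<bar>W B x\<bar>" by (simp flip: abs_mult)
        also have "\<dots> \<le> real z * real z" using W_bnd AB by (intro mult_mono) auto
        finally show ?thesis by (simp add: power2_eq_square)
      qed
      show "(\<Sum>x<\<Prod>C. W A x * W B x) \<ge> 0" unfolding S' using c_nonneg[OF AB(1)] by (auto intro!: mult_nonneg_nonneg prod_nonneg)
    qed (use pos in auto)
    also have "real X / real (\<Prod>C) * (\<Sum>x<\<Prod>C. W A x * W B x) = (if A = B then real X * c A else 0)"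
      unfolding S' using pos by (cases "A = B") (simp_all add: C_def del: of_nat_prod)
    also have "real (\<Prod>C) * (real z ^ 2) \<le> real z ^ 2 * real z ^ 2"
      using Cz by (intro mult_right_mono) auto
    finally show ?thesis by (simp flip: power_add)
  qed
  \<comment> \<open>The empty set contributes 1. This lets the error term take a factor
    \<open>G\<close> as well, so that one power of \<open>G\<close> cancels at the end.\<close>
  have G1: "G \<ge> 1"
  proof -
    have "{} \<in> ?D" using \<open>z \<ge> 1\<close> by (auto simp: bounded_subsets_def)
    then have "c {} \<le> G" unfolding G_def using c_nonneg Q(1)
      by (intro member_le_sum) auto
    then show ?thesis by (simp add: c_def)
  qed
  have WT: "(\<Sum>A\<in>?D. W A t) = G" if "t \<in> T" for t
    unfolding G_def W_def c_def
    by (intro sum.cong prod.cong) (use T(2)[OF that] DQ in \<open>auto simp: \<psi>_def\<close>)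
  \<comment> \<open>Elements of \<open>T\<close> avoid all removed classes, so the inner sum equals
    \<open>G\<close> there. Positivity of squares extends the outer sum to the whole interval, where
    the main term comes from the diagonal alone.\<close>
  have "real (card T) * G\<^sup>2 = (\<Sum>t\<in>T. (\<Sum>A\<in>?D. W A t)\<^sup>2)" by (simp add: WT)
  also have "\<dots> \<le> (\<Sum>x<X. (\<Sum>A\<in>?D. W A x)\<^sup>2)" using T(1) by (intro sum_mono2) auto
  also have "\<dots> = (\<Sum>x<X. \<Sum>A\<in>?D. \<Sum>B\<in>?D. W A x * W B x)"
    by (simp add: power2_eq_square sum_product)
  also have "\<dots> = (\<Sum>A\<in>?D. \<Sum>B\<in>?D. \<Sum>x<X. W A x * W B x)"
    by (subst sum.swap, intro sum.cong refl, rule sum.swap)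
  also have "\<dots> \<le> (\<Sum>A\<in>?D. \<Sum>B\<in>?D. (if A = B then real X * c A else 0) + real z ^ 4)"
    by (intro sum_mono pair) 
  also have "\<dots> = real X * G + real (card ?D) ^ 2 * real z ^ 4"
    using Q(1) by (simp add: sum.distrib sum.delta' G_def sum_distrib_left power2_eq_square)
  also have "\<dots> \<le> real X * G + real z ^ 2 * real z ^ 4"
    using card_bounded_subsets_le[of Q z] Q by (intro add_left_mono mult_right_mono power_mono) auto
  also have "\<dots> = real X * G + real z ^ 6 * 1" by (simp flip: power_add)
  also have "\<dots> \<le> real X * G + real z ^ 6 * G" using G1 by (intro add_left_mono mult_left_mono) auto
  finally have "(real (card T) * G) * G \<le> (real X + real z ^ 6) * G"
    by (simp add: power2_eq_square algebra_simps)
  then show ?thesis using G1 unfolding G_def c_def by (auto simp: mult_le_cancel_right)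
qed

section \<open>Lower bounds for the sieve sum\<close>

text \<open>Group the integers up to \<open>v\<close> by their set of prime factors: the reciprocals
  of those with set \<open>A\<close> sum to at most the product over \<open>A\<close> of the
  geometric series with sum 1 / (p - 1).\<close>

lemma harm_le_sum_bounded_subsets:
  "harm v \<le> (\<Sum>A\<in>bounded_subsets {p. prime p \<and> p \<le> v} v. \<Prod>p\<in>A. 1 / (real p - 1))"
proof -
  let ?P = "{p. prime p \<and> p \<le> v}"
  let ?I = "prime_factors ` {1..v}"
  have sub: "?I \<subseteq> bounded_subsets ?P v"
  proof (rule image_subsetI)
    fix n assume n: "n \<in> {1..v}"
    have "prime_factors n \<subseteq> ?P"
      using n by (auto simp: prime_factors_dvd dest!: dvd_imp_le)
    moreover have "\<Prod>(prime_factors n) dvd (\<Prod>p\<in>prime_factors n. p ^ multiplicity p n)"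
      by (intro prod_dvd_prod) (auto simp: prime_factors_multiplicity)
    then have "\<Prod>(prime_factors n) dvd n"
      using n by (simp add: prime_factorization_nat[symmetric])
    then have "\<Prod>(prime_factors n) \<le> v" using n by (auto dest!: dvd_imp_le)
    ultimately show "prime_factors n \<in> bounded_subsets ?P v"
      by (simp add: bounded_subsets_def)
  qed
  have fib: "(\<Sum>n\<in>{n \<in> {1..v}. prime_factors n = A}. inverse (real n)) \<le> (\<Prod>p\<in>A. 1 / (real p - 1))"
    if "A \<in> ?I" for A
  proof -
    have A: "finite A" "\<And>p. p \<in> A \<Longrightarrow> prime p" using that by auto
    let ?S = "{n \<in> {1..v}. prime_factors n = A}"
    let ?h = "\<lambda>n. \<lambda>p\<in>A. multiplicity p n"
    have val: "n = (\<Prod>p\<in>A. p ^ ?h n p)" if "n \<in> ?S" for n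
      using that by (auto intro: prime_factorization_nat)
    have inj: "inj_on ?h ?S" 
    proof (rule inj_onI)
      fix x y assume "x \<in> ?S" "y \<in> ?S" and xy: "?h x = ?h y"
      then show "x = y" using val[of x] val[of y] by metis
    qed
    have img: "?h ` ?S \<subseteq> PiE A (\<lambda>_. {1..v})"
    proof (rule image_subsetI)
      fix n assume n: "n \<in> ?S"
      have "multiplicity p n \<in> {1..v}" if "p \<in> A" for p
      proof -
        have "p \<in> prime_factors n" using n that by auto
        then have m: "multiplicity p n > 0" "prime p" by (auto simp: prime_factors_multiplicity)
        have "multiplicity p n < p ^ multiplicity p n" using m prime_gt_1_nat by (intro power_gt_expt) auto
        also have "\<dots> \<le> n" using n by (intro dvd_imp_le multiplicity_dvd) auto
        finally show ?thesis using m n by auto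
      qed
      then show "?h n \<in> PiE A (\<lambda>_. {1..v})" by auto
    qed
    have "(\<Sum>n\<in>?S. inverse (real n)) = (\<Sum>n\<in>?S. \<Prod>p\<in>A. inverse (real p) ^ ?h n p)"
    proof (rule sum.cong)
      fix n assume "n \<in> ?S"
      then have "inverse (real n) = inverse (real (\<Prod>p\<in>A. p ^ ?h n p))" using val by metis
      then show "inverse (real n) = (\<Prod>p\<in>A. inverse (real p) ^ ?h n p)"
        by (simp add: prod_inversef[symmetric] power_inverse o_def)
    qed simp
    also have "\<dots> = (\<Sum>g\<in>?h ` ?S. \<Prod>p\<in>A. inverse (real p) ^ g p)"
      using inj by (simp add: sum.reindex)
    also have "\<dots> \<le> (\<Sum>g\<in>PiE A (\<lambda>_. {1..v}). \<Prod>p\<in>A. inverse (real p) ^ g p)"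
      using A img by (intro sum_mono2 finite_PiE prod_nonneg) auto
    also have "\<dots> = (\<Prod>p\<in>A. \<Sum>k\<in>{1..v}. inverse (real p) ^ k)"
      using A by (subst prod_sum_PiE) auto
    also have "\<dots> \<le> (\<Prod>p\<in>A. 1 / (real p - 1))"
    proof (intro prod_mono conjI)
      fix p assume "p \<in> A"
      then have p: "real p > 1" using A prime_gt_1_nat by force
      have "(\<Sum>k\<in>{1..v}. inverse (real p) ^ k) = (\<Sum>k<v. inverse (real p) ^ Suc k)"
        by (rule sum.reindex_bij_witness[of _ Suc "\<lambda>k. k - 1"]) auto
      also have "\<dots> = inverse (real p) * ((1 - inverse (real p) ^ v) / (1 - inverse (real p)))"
        using p by (simp add: sum_distrib_left[symmetric] sum_gp_strict)
      also have "\<dots> \<le> inverse (real p) * (1 / (1 - inverse (real p)))"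
        using p by (intro mult_left_mono divide_right_mono) (auto simp: field_simps)
      also have "\<dots> = 1 / (real p - 1)" using p by (simp add: field_simps)
      finally show "(\<Sum>k\<in>{1..v}. inverse (real p) ^ k) \<le> 1 / (real p - 1)" .
    qed (auto intro: sum_nonneg)
    finally show ?thesis .
  qed
  have "harm v = (\<Sum>A\<in>?I. \<Sum>n\<in>{n \<in> {1..v}. prime_factors n = A}. inverse (real n))"
    unfolding harm_def by (rule sum.image_gen) simp
  also have "\<dots> \<le> (\<Sum>A\<in>?I. \<Prod>p\<in>A. 1 / (real p - 1))" by (intro sum_mono fib)
  also have "\<dots> \<le> (\<Sum>A\<in>bounded_subsets ?P v. \<Prod>p\<in>A. 1 / (real p - 1))"
  proof (intro sum_mono2 sub prod_nonneg)
    fix A p assume "A \<in> bounded_subsets ?P v - ?I" "p \<in> A"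
    then have "prime p" by (auto simp: bounded_subsets_def)
    then show "1 / (real p - 1) \<ge> 0" using prime_gt_1_nat[of p] by auto
  qed auto
  finally show ?thesis .
qed

lemma prod_nat_mono_subset:
  fixes A C :: "nat set"
  assumes "A \<subseteq> C" "finite C" "0 \<notin> C"
  shows "\<Prod>A \<le> \<Prod>C"
  using assms by (intro dvd_imp_le prod_dvd_prod_subset) (auto intro!: Nat.gr0I)

text \<open>Split each set into its parts inside and outside \<open>B\<close>. The outer part still
  has product at most \<open>v\<close>, and the inner parts, now unrestricted, sum to the Euler
  product over \<open>B\<close>. This measures the loss from primes that the sieve must
  skip.\<close>

lemma sum_bounded_subsets_remove_le:
  fixes u :: "nat \<Rightarrow> real"
  assumes "finite P" "B \<subseteq> P" "0 \<notin> P" "\<And>p. p \<in> P \<Longrightarrow> u p \<ge> 0"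
  shows "(\<Sum>A\<in>bounded_subsets P v. prod u A) \<le> (\<Prod>p\<in>B. 1 + u p) * (\<Sum>A\<in>bounded_subsets (P - B) v. prod u A)"
proof -
  let ?h = "\<lambda>A. (A \<inter> B, A - B)"
  let ?g = "\<lambda>(A, A'). prod u A * prod u A'"
  have fin: "finite B" "finite (P - B)" using assms by (auto intro: finite_subset)
  have inj: "inj_on ?h (bounded_subsets P v)" by (rule inj_onI) blast
  have img: "?h ` bounded_subsets P v \<subseteq> Pow B \<times> bounded_subsets (P - B) v"
  proof (rule image_subsetI)
    fix A assume A: "A \<in> bounded_subsets P v"
    then have "\<Prod>(A - B) \<le> \<Prod>A"
      using assms by (intro prod_nat_mono_subset) (auto simp: bounded_subsets_def intro: finite_subset)
    then show "?h A \<in> Pow B \<times> bounded_subsets (P - B) v" using A by (auto simp: bounded_subsets_def)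
  qed
  have "(\<Sum>A\<in>bounded_subsets P v. prod u A) = (\<Sum>A\<in>bounded_subsets P v. ?g (?h A))"
  proof (rule sum.cong)
    fix A assume "A \<in> bounded_subsets P v"
    then have "finite A" using assms by (auto simp: bounded_subsets_def intro: finite_subset)
    then show "prod u A = ?g (?h A)" by (simp add: prod.Int_Diff)
  qed simp
  also have "\<dots> = (\<Sum>x\<in>?h ` bounded_subsets P v. ?g x)" by (simp add: sum.reindex[OF inj])
  also have "\<dots> \<le> (\<Sum>x\<in>Pow B \<times> bounded_subsets (P - B) v. ?g x)"
  proof (intro sum_mono2 img)
    fix x assume "x \<in> Pow B \<times> bounded_subsets (P - B) v - ?h ` bounded_subsets P v"
    then have "x \<in> Pow B \<times> bounded_subsets (P - B) v" by blast
    then obtain A A' where "x = (A, A')" "A \<in> Pow B" "A' \<in> bounded_subsets (P - B) v" by (rule SigmaE)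
    then have x: "x = (A, A')" "A \<subseteq> P" "A' \<subseteq> P"
      using assms(2) by (auto simp: bounded_subsets_def)
    then have "prod u A \<ge> 0" "prod u A' \<ge> 0" using assms(4) by (auto intro!: prod_nonneg)
    then show "?g x \<ge> 0" using x by simp
  qed (use fin in auto)
  also have "\<dots> = (\<Sum>A\<in>Pow B. prod u A) * (\<Sum>A\<in>bounded_subsets (P - B) v. prod u A)"
    by (simp add: sum_product sum.cartesian_product)
  also have "(\<Sum>A\<in>Pow B. prod u A) = (\<Prod>p\<in>B. 1 + u p)"
    using prod_add[OF fin(1), of u "\<lambda>_. 1"] by (simp add: add.commute)
  finally show ?thesis .
qed

text \<open>Each element of \<open>C\<close> lies in \<open>A\<close> only, in \<open>B\<close> only
  or in both, which gives the local factor u + u + u^2. The proof chooses \<open>A\<close> and then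
  the part of \<open>B\<close> inside \<open>A\<close>.\<close>

lemma sum_pairs_union:
  fixes u :: "'a \<Rightarrow> real"
  assumes "finite C"
  shows "(\<Sum>(A, B)\<in>{(A, B). A \<union> B = C}. prod u A * prod u B) = (\<Prod>p\<in>C. u p * (1 + u p) + u p)"
proof -
  have "(\<Sum>(A, B)\<in>{(A, B). A \<union> B = C}. prod u A * prod u B)
      = (\<Sum>(A, B)\<in>Sigma (Pow C) Pow. prod u A * (prod u B * prod u (C - A)))"
  proof (rule sum.reindex_bij_witness[of _ "\<lambda>(A, B). (A, B \<union> (C - A))" "\<lambda>(A, B). (A, A \<inter> B)"], goal_cases)
    case (5 a)
    then obtain A B where a: "a = (A, B)" "A \<union> B = C" by auto
    have "prod u B = prod u ((A \<inter> B) \<union> (C - A))" using a by (intro arg_cong[of _ _ "prod u"]) blast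
    also have "\<dots> = prod u (A \<inter> B) * prod u (C - A)"
      using a assms by (intro prod.union_disjoint) auto
    finally show ?case by (simp add: a)
  qed auto
  also have "\<dots> = (\<Sum>A\<in>Pow C. \<Sum>B\<in>Pow A. prod u A * (prod u B * prod u (C - A)))"
    using assms by (subst sum.Sigma) (auto intro: finite_subset)
  also have "\<dots> = (\<Sum>A\<in>Pow C. (\<Prod>p\<in>A. u p * (1 + u p)) * prod u (C - A))"
  proof (rule sum.cong)
    fix A assume "A \<in> Pow C"
    then have "finite A" using assms by (auto intro: finite_subset)
    then have "(\<Sum>B\<in>Pow A. prod u B) = (\<Prod>p\<in>A. 1 + u p)"
      using prod_add[of A u "\<lambda>_. 1"] by (simp add: add.commute)
    then show "(\<Sum>B\<in>Pow A. prod u A * (prod u B * prod u (C - A))) = (\<Prod>p\<in>A. u p * (1 + u p)) * prod u (C - A)"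
      by (simp add: prod.distrib sum_distrib_left[symmetric] sum_distrib_right[symmetric])
  qed simp
  also have "\<dots> = (\<Prod>p\<in>C. u p * (1 + u p) + u p)"
    using prod_add[OF assms, of "\<lambda>p. u p * (1 + u p)" u] by simp
  finally show ?thesis .
qed

text \<open>Squaring passes from dimension one to dimension two: a pair of sets at level
  \<open>v\<close> has a union at level v^2, and the pairs with a given union have local weight 2 u
  + u^2, which is at most 2 / (p - 2). The harmonic sum thus becomes a lower bound of order (ln
  v)^2.\<close>

lemma square_sum_prime_sets_le:
  assumes "finite Q" "\<And>p. p \<in> Q \<Longrightarrow> p > 2" "v\<^sup>2 \<le> z"
  shows "(\<Sum>A\<in>bounded_subsets Q v. \<Prod>p\<in>A. 1 / (real p - 1))\<^sup>2 \<le> (\<Sum>A\<in>bounded_subsets Q z. \<Prod>p\<in>A. 2 / (real p - 2))"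
proof -
  define u where "u p = 1 / (real p - 1)" for p :: nat
  let ?D = "bounded_subsets Q v" and ?E = "bounded_subsets Q z"
  have u: "u p \<ge> 0" if "p \<in> Q" for p using assms(2)[OF that] by (auto simp: u_def)
  have fin: "finite A" if "A \<subseteq> Q" for A using that assms(1) by (rule finite_subset)
  have img: "(\<lambda>(A, B). A \<union> B) ` (?D \<times> ?D) \<subseteq> ?E"
  proof clarify
    fix A B assume AB: "A \<in> ?D" "B \<in> ?D"
    have f: "finite A" "finite B" using AB fin by (auto simp: bounded_subsets_def)
    have "\<Prod>(A \<inter> B) > 0"
      using AB assms(2) by (intro prod_pos) (force simp: bounded_subsets_def)
    then have "\<Prod>(A \<union> B) \<le> \<Prod>(A \<union> B) * \<Prod>(A \<inter> B)" by simp
    also have "\<dots> = \<Prod>A * \<Prod>B" using f by (intro prod.union_inter)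
    also have "\<dots> \<le> v * v" using AB by (intro mult_mono) (auto simp: bounded_subsets_def)
    also have "\<dots> \<le> z" using assms(3) by (simp add: power2_eq_square)
    finally show "A \<union> B \<in> ?E" using AB by (auto simp: bounded_subsets_def)
  qed
  have "(\<Sum>A\<in>?D. prod u A)\<^sup>2 = (\<Sum>(A, B)\<in>?D \<times> ?D. prod u A * prod u B)"
    by (simp add: power2_eq_square sum_product sum.cartesian_product)
  also have "\<dots> = (\<Sum>C\<in>?E. \<Sum>(A, B)\<in>{x \<in> ?D \<times> ?D. (\<lambda>(A, B). A \<union> B) x = C}. prod u A * prod u B)"
    using assms(1) img by (intro sum.group[symmetric]) auto
  also have "\<dots> \<le> (\<Sum>C\<in>?E. \<Prod>p\<in>C. 2 / (real p - 2))"
  proof (rule sum_mono)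
    fix C assume "C \<in> ?E"
    then have C: "C \<subseteq> Q" by (auto simp: bounded_subsets_def)
    have "finite (Pow C \<times> Pow C)" using fin[OF C] by simp
    then have "finite {(A, B). A \<union> B = C}" by (rule finite_subset[rotated]) auto
    then have "(\<Sum>(A, B)\<in>{x \<in> ?D \<times> ?D. (\<lambda>(A, B). A \<union> B) x = C}. prod u A * prod u B)
      \<le> (\<Sum>(A, B)\<in>{(A, B). A \<union> B = C}. prod u A * prod u B)"
      using C u by (intro sum_mono2) (auto intro!: mult_nonneg_nonneg prod_nonneg)
    also have "\<dots> = (\<Prod>p\<in>C. u p * (1 + u p) + u p)" by (rule sum_pairs_union[OF fin[OF C]])
    also have "\<dots> \<le> (\<Prod>p\<in>C. 2 / (real p - 2))"
    proof (intro prod_mono conjI)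
      fix p assume p: "p \<in> C"
      then have "p > 2" using C assms(2) by auto
      then obtain r where r: "real p = r + 2" "r > 0" by (metis add.commute less_add_same_cancel2 of_nat_less_iff of_nat_numeral diff_add_cancel diff_gt_0_iff_gt)
      show "0 \<le> u p * (1 + u p) + u p" using u[of p] p C by (auto intro!: add_nonneg_nonneg mult_nonneg_nonneg)
      show "u p * (1 + u p) + u p \<le> 2 / (real p - 2)"
      proof -
        \<comment> \<open>In terms of \<open>r\<close> the weight \<open>u p\<close> is 1 / (r + 1),
          and 2 (r + 1)^2 exceeds r (2 r + 3) by \<open>r + 2\<close>.\<close>
        have "u p * (1 + u p) + u p = (2 * r + 3) / (r + 1)\<^sup>2"
          using r by (simp add: u_def power2_eq_square divide_simps) (simp add: algebra_simps)
        also have "\<dots> \<le> 2 / r"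
          using r by (simp add: frac_le_eq power2_eq_square divide_le_0_iff zero_le_divide_iff) (simp add: algebra_simps)
        finally show ?thesis using r by simp
      qed
    qed
    finally show "(\<Sum>(A, B)\<in>{x \<in> ?D \<times> ?D. (\<lambda>(A, B). A \<union> B) x = C}. prod u A * prod u B) \<le> (\<Prod>p\<in>C. 2 / (real p - 2))" .
  qed
  finally show ?thesis unfolding u_def .
qed

section \<open>Pairs of primes on a line\<close>

lemma ex1_root_linear_mod_prime:
  fixes p a b :: nat
  assumes "prime p" "\<not> p dvd a"
  shows "\<exists>!r. r < p \<and> p dvd a * r + b"
proof (rule ex_ex1I)
  have "coprime a p" using assms by (meson coprime_commute prime_imp_coprime)
  then obtain x where x: "[a * x = Suc 0] (mod p)" using cong_solve_coprime_nat by auto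
  \<comment> \<open>The factor \<open>b * (p - 1)\<close> plays the role of -b modulo
    \<open>p\<close>, so that the root stays a natural number.\<close>
  have "[a * (x * (b * (p - 1))) + b = Suc 0 * (b * (p - 1)) + b] (mod p)"
    using cong_mult[OF x cong_refl, of "b * (p - 1)"] by (intro cong_add) (auto simp: mult.assoc)
  also have "Suc 0 * (b * (p - 1)) + b = p * b"
    using prime_gt_0_nat[OF assms(1)] by (cases p) (auto simp: algebra_simps)
  finally have "p dvd a * (x * (b * (p - 1))) + b" by (simp add: cong_dvd_iff)
  moreover have "[a * (x * (b * (p - 1)) mod p) + b = a * (x * (b * (p - 1))) + b] (mod p)"
    by (intro cong_add cong_mult) (auto simp: cong_def)
  ultimately have "p dvd a * (x * (b * (p - 1)) mod p) + b" by (simp add: cong_dvd_iff)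
  then show "\<exists>r. r < p \<and> p dvd a * r + b" using prime_gt_0_nat[OF assms(1)] by (meson mod_less_divisor)
next
  fix r s assume r: "r < p \<and> p dvd a * r + b" and s: "s < p \<and> p dvd a * s + b"
  then have "[a * r + b = a * s + b] (mod p)" by (auto simp: cong_def mod_eq_0_iff_dvd[symmetric])
  then have "[a * r = a * s] (mod p)" by (simp add: cong_add_rcancel_nat)
  moreover have "coprime a p" using assms by (meson coprime_commute prime_imp_coprime)
  ultimately have "[r = s] (mod p)" by (simp add: cong_mult_lcancel_nat)
  then show "r = s" using r s by (simp add: cong_less_modulus_unique_nat)
qed

text \<open>\<open>H\<close> collects the primes at which fewer than two classes may be excluded: a
  leading coefficient vanishes, or the two roots coincide because the determinant vanishes. These
  primes and 2, where no class might survive, are left out of the sieve at the cost of the product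
  on the right.\<close>

lemma sieve_two_linear_forms:
  fixes a b c d H :: nat and T :: "nat set"
  assumes good: "\<And>p. prime p \<Longrightarrow> \<not> p dvd H \<Longrightarrow>
      \<not> p dvd a \<and> \<not> p dvd c \<and> \<not> int p dvd int a * int d - int c * int b"
    and T: "T \<subseteq> {..<X}"
      "\<And>t p. t \<in> T \<Longrightarrow> prime p \<Longrightarrow> p \<le> v \<Longrightarrow> \<not> p dvd a * t + b \<and> \<not> p dvd c * t + d"
    and "z \<ge> 1" "v\<^sup>2 \<le> z"
  shows "real (card T) * (harm v)\<^sup>2
    \<le> (real X + real z ^ 6) * (\<Prod>p | prime p \<and> p \<le> v \<and> (p = 2 \<or> p dvd H). 1 + 1 / (real p - 1))\<^sup>2"
proof -
  define P where "P = {p. prime p \<and> p \<le> v}"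
  define B where "B = {p. prime p \<and> p \<le> v \<and> (p = 2 \<or> p dvd H)}"
  define Q where "Q = P - B"
  define u where "u p = 1 / (real p - 1)" for p :: nat
  define R where "R p = {r. r < p \<and> (p dvd a * r + b \<or> p dvd c * r + d)}" for p
  define G where "G = (\<Sum>A\<in>bounded_subsets Q z. \<Prod>p\<in>A. 2 / (real p - 2))"
  define S where "S = (\<Sum>A\<in>bounded_subsets Q v. prod u A)"
  have fin: "finite P" by (simp add: P_def)
  have Q: "finite Q" "prime p" "p > 2" "\<not> p dvd H" "p \<le> v" if "p \<in> Q" for p
    using that fin prime_ge_2_nat[of p] by (auto simp: Q_def P_def B_def)
  have finQ: "finite Q" using fin by (simp add: Q_def)
  have card_R: "card (R p) = 2" if p: "p \<in> Q" for p
  proof -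
    have g: "\<not> p dvd a" "\<not> p dvd c" "\<not> int p dvd int a * int d - int c * int b"
      using good[OF Q(2,4)[OF p]] by auto
    obtain r where r: "r < p" "p dvd a * r + b" "\<And>r'. r' < p \<Longrightarrow> p dvd a * r' + b \<Longrightarrow> r' = r"
      using ex1_root_linear_mod_prime[OF Q(2)[OF p] g(1), of b] by metis
    obtain s where s: "s < p" "p dvd c * s + d" "\<And>s'. s' < p \<Longrightarrow> p dvd c * s' + d \<Longrightarrow> s' = s"
      using ex1_root_linear_mod_prime[OF Q(2)[OF p] g(2), of d] by metis
    have "r \<noteq> s"
    proof
      assume "r = s"
      then have "int p dvd int (a * r + b)" "int p dvd int (c * r + d)"
        using r(2) s(2) by (auto simp: int_dvd_int_iff simp del: of_nat_add of_nat_mult)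
      then have "int p dvd int a * int (c * r + d) - int c * int (a * r + b)"
        by (intro dvd_diff dvd_mult)
      also have "int a * int (c * r + d) - int c * int (a * r + b) = int a * int d - int c * int b"
        by (simp add: algebra_simps)
      finally show False using g(3) by simp
    qed
    moreover have "R p = {r, s}" using r s unfolding R_def by blast
    ultimately show ?thesis by simp
  qed
  have 1: "real (card T) * G \<le> real X + real z ^ 6"
    unfolding G_def
  proof (rule orthogonality_sieve[where R = R])
    show "t mod p \<notin> R p" if "t \<in> T" "p \<in> Q" for t p
    proof
      assume "t mod p \<in> R p"
      then have "p dvd a * (t mod p) + b \<or> p dvd c * (t mod p) + d" by (simp add: R_def)
      moreover have "[a * (t mod p) + b = a * t + b] (mod p)" "[c * (t mod p) + d = c * t + d] (mod p)"
        unfolding cong_def by (metis mod_add_left_eq mod_mult_right_eq)+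
      ultimately have "p dvd a * t + b \<or> p dvd c * t + d" by (auto simp: cong_dvd_iff)
      then show False using T(2)[OF that(1) Q(2,5)[OF that(2)]] by simp
    qed
  qed (use Q finQ card_R T(1) assms in \<open>auto simp: R_def\<close>)
  have 2: "S\<^sup>2 \<le> G" unfolding S_def u_def G_def
    by (rule square_sum_prime_sets_le) (use finQ Q assms in auto)
  have "harm v \<le> (\<Sum>A\<in>bounded_subsets P v. prod u A)"
    using harm_le_sum_bounded_subsets[of v] by (simp add: P_def u_def)
  also have "\<dots> \<le> (\<Prod>p\<in>B. 1 + u p) * S"
    unfolding S_def Q_def
  proof (rule sum_bounded_subsets_remove_le)
    show "u p \<ge> 0" if "p \<in> P" for p using that prime_gt_1_nat[of p] by (auto simp: u_def P_def)
  qed (use fin in \<open>auto simp: P_def B_def\<close>)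
  finally have "(harm v)\<^sup>2 \<le> ((\<Prod>p\<in>B. 1 + u p) * S)\<^sup>2"
    using harm_nonneg[of v, where ?'a = real] by (intro power_mono) 
  also have "\<dots> \<le> (\<Prod>p\<in>B. 1 + u p)\<^sup>2 * G"
    unfolding power_mult_distrib using 2 by (intro mult_left_mono) auto
  finally have "real (card T) * (harm v)\<^sup>2 \<le> real (card T) * ((\<Prod>p\<in>B. 1 + u p)\<^sup>2 * G)"
    by (intro mult_left_mono) auto
  also have "\<dots> = (real (card T) * G) * (\<Prod>p\<in>B. 1 + u p)\<^sup>2" by simp
  also have "\<dots> \<le> (real X + real z ^ 6) * (\<Prod>p\<in>B. 1 + u p)\<^sup>2"
    using 1 by (intro mult_right_mono) auto
  finally show ?thesis unfolding B_def u_def .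
qed

section \<open>Singular products and solutions of p q - p' q' = h\<close>

text \<open>This is (p / (p - 1))^2, the price of leaving \<open>p\<close> out of a sieve of
  dimension two.\<close>

definition local_factor :: "nat \<Rightarrow> real" where
  "local_factor p = (1 + 1 / (real p - 1))\<^sup>2"

definition singular_product :: "nat \<Rightarrow> nat \<Rightarrow> real" where
  "singular_product v h = (\<Prod>p | prime p \<and> p \<le> v \<and> p dvd h. local_factor p)"

lemma local_factor_bounds:
  assumes "prime p"
  shows "local_factor p \<ge> 1" "local_factor p \<le> 4"
proof -
  have "1 / (real p - 1) \<ge> 0" "1 / (real p - 1) \<le> 1"
    using prime_ge_2_nat[OF assms] by (auto simp: field_simps)
  then show "local_factor p \<ge> 1" "local_factor p \<le> 4"
    unfolding local_factor_def using power_mono[of "1 + 1 / (real p - 1)" 2 2] by (auto simp: one_le_power)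
qed

lemma singular_product_ge_1: "singular_product v h \<ge> 1"
  unfolding singular_product_def using local_factor_bounds by (intro prod_ge_1) auto

text \<open>The set \<open>E\<close> holds the few exceptional primes that need not divide
  \<open>h\<close>, namely 2 and possibly the small prime factors; each costs a factor of at most 4,
  the value at the prime 2.\<close>

lemma exceptional_product_le:
  assumes "finite E" "\<And>p. p \<in> E \<Longrightarrow> prime p" "2 \<in> E" "\<And>p. prime p \<Longrightarrow> p dvd H \<Longrightarrow> p \<in> E \<or> p dvd h"
  shows "(\<Prod>p | prime p \<and> p \<le> v \<and> (p = 2 \<or> p dvd H). 1 + 1 / (real p - 1))\<^sup>2 \<le> 4 ^ card E * singular_product v h"
proof -
  let ?B = "{p. prime p \<and> p \<le> v \<and> (p = 2 \<or> p dvd H)}" and ?F = "{p. prime p \<and> p \<le> v \<and> p dvd h}"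
  have "(\<Prod>p\<in>?B. 1 + 1 / (real p - 1))\<^sup>2 = (\<Prod>p\<in>?B. local_factor p)"
    by (simp add: local_factor_def prod_power_distrib)
  also have "\<dots> \<le> (\<Prod>p\<in>E \<union> (?F - E). local_factor p)"
    using assms local_factor_bounds by (intro prod_mono2) (auto intro: order_trans[OF zero_le_one])
  also have "\<dots> = (\<Prod>p\<in>E. local_factor p) * (\<Prod>p\<in>?F - E. local_factor p)"
    using assms by (intro prod.union_disjoint) auto
  also have "\<dots> \<le> (\<Prod>p\<in>E. 4) * (\<Prod>p\<in>?F. local_factor p)"
    using assms local_factor_bounds
    by (intro mult_mono prod_mono prod_mono2 prod_nonneg) (auto intro: order_trans[OF zero_le_one])
  finally show ?thesis by (simp add: singular_product_def)
qed

text \<open>In the application \<open>h\<close> is a difference of two self-powers. As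
  \<open>q\<close> and \<open>q'\<close> are primes above \<open>z\<close>, sieving by primes up to
  \<open>v\<close>, at most \<open>z\<close>, discards no solution.\<close>

definition weighted_prime_pairs :: "nat \<Rightarrow> nat \<Rightarrow> nat \<Rightarrow> nat \<Rightarrow> nat \<Rightarrow> (nat \<times> nat) set" where
  "weighted_prime_pairs N z h p p' =
     {(q, q'). prime q \<and> prime q' \<and> q > z \<and> q' > z \<and> p * q = p' * q' + h \<and> p * q \<le> N}"

lemma prime_gt_not_dvd:
  assumes "prime (q::nat)" "prime p" "p \<le> v" "v \<le> z" "z < q"
  shows "\<not> p dvd q"
  using primes_dvd_imp_eq[OF assms(2,1)] assms by auto

text \<open>Here \<open>p\<close> must divide \<open>h\<close>, and the equation reduces to a fixed
  difference of two primes up to N / p. The bound has 1 / p where distinct primes give 1 / (p p'),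
  so the diagonal will cost \<open>L\<close> instead of L^2.\<close>

lemma card_weighted_prime_pairs_same:
  assumes "prime p" "p \<le> z" "h > 0" "z ^ 8 \<le> N" "v\<^sup>2 \<le> z"
  shows "real (card (weighted_prime_pairs N z h p p)) * (harm v)\<^sup>2 \<le> 200 * (real N / real p) * singular_product v h"
proof (cases "p dvd h")
  case False
  then have "weighted_prime_pairs N z h p p = {}"
    by (auto simp: weighted_prime_pairs_def) (metis dvd_add_right_iff dvd_triv_left)
  then show ?thesis using singular_product_ge_1[of v h] by simp
next
  case True
  then obtain k where k: "h = p * k" by auto
  have p0: "p > 0" and z1: "z \<ge> 1" using assms prime_ge_2_nat[of p] by auto
  have vz: "v \<le> z" using assms(5) by (metis le_square order_trans power2_eq_square)
  define X where "X = N div p + 1"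
  define T where "T = {t. (t + k, t) \<in> weighted_prime_pairs N z h p p}"
  have W: "weighted_prime_pairs N z h p p = (\<lambda>t. (t + k, t)) ` T"
    using p0 by (auto simp: T_def weighted_prime_pairs_def k image_iff simp flip: distrib_left)
  have TX: "T \<subseteq> {..<X}"
  proof
    fix t assume "t \<in> T"
    then have "t * p \<le> N" by (auto simp: T_def weighted_prime_pairs_def algebra_simps)
    then show "t \<in> {..<X}" using p0 by (simp add: X_def less_eq_div_iff_mult_less_eq less_Suc_eq_le)
  qed
  have "real (card T) * (harm v)\<^sup>2
    \<le> (real X + real z ^ 6) * (\<Prod>p | prime p \<and> p \<le> v \<and> (p = 2 \<or> p dvd k). 1 + 1 / (real p - 1))\<^sup>2"
  proof (rule sieve_two_linear_forms[where a = 1 and b = k and c = 1 and d = 0])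
    fix t q assume t: "t \<in> T" "prime q" "q \<le> v"
    then show "\<not> q dvd 1 * t + k \<and> \<not> q dvd 1 * t + 0"
      using vz by (auto simp: T_def weighted_prime_pairs_def dest: prime_gt_not_dvd)
  qed (use TX z1 assms in auto)
  also have "\<dots> \<le> (3 * (real N / real p)) * (4 * singular_product v h)"
  proof (intro mult_mono)
    have "real p * real z ^ 6 \<le> real z * real z ^ 7"
      using assms(2) z1 by (intro mult_mono power_increasing) auto
    also have "\<dots> = real (z ^ 8)" by (simp add: eval_nat_numeral)
    also have "\<dots> \<le> real N" using assms(4) by (simp del: of_nat_power)
    finally have 1: "real z ^ 6 \<le> real N / real p" using p0 by (simp add: field_simps)
    have 2: "1 \<le> real z ^ 6" using z1 by (intro one_le_power) auto
    have "real (N div p) \<le> real N / real p" by (rule of_nat_div_le_of_nat)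
    then show "real X + real z ^ 6 \<le> 3 * (real N / real p)" using 1 2 by (simp add: X_def)
    show "(\<Prod>p | prime p \<and> p \<le> v \<and> (p = 2 \<or> p dvd k). 1 + 1 / (real p - 1))\<^sup>2 \<le> 4 * singular_product v h"
      using exceptional_product_le[of "{2}" k h v] by (auto simp: k)
  qed auto
  also have "\<dots> \<le> 200 * (real N / real p) * singular_product v h"
    using singular_product_ge_1[of v h] p0 by (auto simp: field_simps)
  finally show ?thesis unfolding W by (subst card_image) (auto intro: inj_onI)
qed

lemma card_weighted_prime_pairs_distinct:
  assumes "prime p" "prime p'" "p \<noteq> p'" "p \<le> z" "p' \<le> z" "h > 0" "z ^ 8 \<le> N" "v\<^sup>2 \<le> z"
  shows "real (card (weighted_prime_pairs N z h p p')) * (harm v)\<^sup>2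
    \<le> 200 * (real N / (real p * real p')) * singular_product v h"
proof (cases "weighted_prime_pairs N z h p p' = {}")
  case True
  then show ?thesis using singular_product_ge_1[of v h] by simp
next
  case False
  let ?W = "weighted_prime_pairs N z h p p'"
  have p0: "p > 0" "p' > 0" and z1: "z \<ge> 1" using assms prime_ge_2_nat[of p] prime_ge_2_nat[of p'] by auto
  have vz: "v \<le> z" using assms(8) by (metis le_square order_trans power2_eq_square)
  \<comment> \<open>The solution with the least \<open>q\<close> parametrizes all others as \<open>(x + p' t, y + p t)\<close> with natural \<open>t\<close>.\<close>
  define x where "x = (LEAST x. x \<in> fst ` ?W)"
  have "\<exists>x. x \<in> fst ` ?W" using False by blast
  then have "x \<in> fst ` ?W" unfolding x_def by (rule LeastI_ex)
  then obtain y where xy: "(x, y) \<in> ?W" by auto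
  have min: "x \<le> q" if "(q, q') \<in> ?W" for q q'
  proof -
    have "q \<in> fst ` ?W" using that by (metis fst_conv imageI)
    then show ?thesis unfolding x_def by (rule Least_le)
  qed
  define X where "X = N div (p * p') + 1"
  define f where "f t = (x + p' * t, y + p * t)" for t
  define T where "T = {t. f t \<in> ?W}"
  have cop: "coprime p p'" using assms by (simp add: primes_coprime)
  have W: "?W = f ` T"
  proof
    show "?W \<subseteq> f ` T"
    proof
      fix w assume w: "w \<in> ?W"
      obtain q q' where qq: "w = (q, q')" by (cases w)
      have "x \<le> q" using min w qq by auto
      then obtain s where s: "q = x + s" using le_Suc_ex by auto
      have e: "p * x = p' * y + h" "p * q = p' * q' + h"
        using xy w qq by (auto simp: weighted_prime_pairs_def)
      then have "p' * q' = p' * y + p * s" using s by (simp add: algebra_simps)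
      then have "p' dvd p * s" by (metis dvd_add_right_iff dvd_triv_left)
      then have "p' dvd s" using cop by (simp add: coprime_commute coprime_dvd_mult_right_iff)
      then obtain t where t: "s = p' * t" by auto
      have "p' * q' = p' * (y + p * t)" using \<open>p' * q' = p' * y + p * s\<close> t by (simp add: algebra_simps)
      then have "q' = y + p * t" using p0 by simp
      then have "w = f t" using qq s t by (simp add: f_def)
      then show "w \<in> f ` T" using w by (auto simp: T_def)
    qed
  qed (auto simp: T_def)
  have TX: "T \<subseteq> {..<X}"
  proof
    fix t assume "t \<in> T"
    then have "p * (x + p' * t) \<le> N" by (auto simp: T_def f_def weighted_prime_pairs_def)
    then have "t * (p * p') \<le> N" by (simp add: algebra_simps)
    then show "t \<in> {..<X}" using p0 by (simp add: X_def less_eq_div_iff_mult_less_eq less_Suc_eq_le)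
  qed
  \<comment> \<open>The determinant of the two forms is -h for whichever base solution is chosen, so
    the bad primes divide h p p', and the bound does not depend on that choice.\<close>
  have det: "int p' * int y - int p * int x = - int h"
  proof -
    have "int (p * x) = int (p' * y + h)" using xy by (auto simp: weighted_prime_pairs_def)
    then show ?thesis by simp
  qed
  have "real (card T) * (harm v)\<^sup>2
    \<le> (real X + real z ^ 6) * (\<Prod>q | prime q \<and> q \<le> v \<and> (q = 2 \<or> q dvd h * p * p'). 1 + 1 / (real q - 1))\<^sup>2"
  proof (rule sieve_two_linear_forms[where a = p' and b = x and c = p and d = y])
    fix t q assume t: "t \<in> T" "prime q" "q \<le> v"
    then show "\<not> q dvd p' * t + x \<and> \<not> q dvd p * t + y"
      using vz by (auto simp: T_def f_def weighted_prime_pairs_def add.commute dest: prime_gt_not_dvd)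
  next
    fix q assume q: "prime q" "\<not> q dvd h * p * p'"
    then show "\<not> q dvd p' \<and> \<not> q dvd p \<and> \<not> int q dvd int p' * int y - int p * int x"
      unfolding det by auto
  qed (use TX z1 assms in auto)
  also have "\<dots> \<le> (3 * (real N / (real p * real p'))) * (64 * singular_product v h)"
  proof (intro mult_mono)
    \<comment> \<open>The origin of the exponent 8: the sieve error z^6 must not exceed N / (p p'),
      and p p' is at most z^2. The final constant 200 rounds up 3 * 64, with 64 = 4^3 for the
      exceptional primes 2, \<open>p\<close> and \<open>p'\<close>.\<close>
    have "(real p * real p') * real z ^ 6 \<le> (real z * real z) * real z ^ 6"
      using assms by (intro mult_mono) auto
    also have "\<dots> = real (z ^ 8)" by (simp add: eval_nat_numeral)
    also have "\<dots> \<le> real N" using assms(7) by (simp del: of_nat_power)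
    finally have 1: "real z ^ 6 \<le> real N / (real p * real p')" using p0 by (simp add: field_simps)
    have 2: "1 \<le> real z ^ 6" using z1 by (intro one_le_power) auto
    have "real (N div (p * p')) \<le> real N / (real p * real p')"
      using of_nat_div_le_of_nat[of N "p * p'"] by simp
    then show "real X + real z ^ 6 \<le> 3 * (real N / (real p * real p'))" using 1 2 by (simp add: X_def)
    have "card {2, p, p'} \<le> 3" by (simp add: card_insert_if)
    then have "4 ^ card {2, p, p'} * singular_product v h \<le> 4 ^ 3 * singular_product v h"
      using singular_product_ge_1[of v h] by (intro mult_right_mono power_increasing) auto
    moreover have "(\<Prod>q | prime q \<and> q \<le> v \<and> (q = 2 \<or> q dvd h * p * p'). 1 + 1 / (real q - 1))\<^sup>2
        \<le> 4 ^ card {2, p, p'} * singular_product v h"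
      using assms by (intro exceptional_product_le) (auto simp: prime_dvd_mult_iff primes_dvd_imp_eq)
    ultimately show "(\<Prod>q | prime q \<and> q \<le> v \<and> (q = 2 \<or> q dvd h * p * p'). 1 + 1 / (real q - 1))\<^sup>2
        \<le> 64 * singular_product v h" by simp
  qed auto
  also have "\<dots> \<le> 200 * (real N / (real p * real p')) * singular_product v h"
    using singular_product_ge_1[of v h] p0 by (auto simp: field_simps)
  finally show ?thesis unfolding W using p0 by (subst card_image) (auto intro!: inj_onI simp: f_def)
qed

section \<open>Chebyshev bounds\<close>

lemma prod_primes_dvd:
  fixes n :: nat
  assumes "finite A" "\<And>p. p \<in> A \<Longrightarrow> prime p" "\<And>p. p \<in> A \<Longrightarrow> p dvd n"
  shows "\<Prod>A dvd n"
  using assms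
proof (induction A rule: finite_induct)
  case (insert p A)
  have "coprime p (\<Prod>A)" using insert by (intro prod_coprime_right primes_coprime) auto
  then show ?case using insert by (simp add: divides_mult)
qed simp

text \<open>Chebyshev: primes in (n, 2n] all divide the central binomial coefficient, which is at
  most 4^n, so there are at most n ln 4 / ln n of them, each with reciprocal below 1 / n.\<close>

lemma sum_inverse_primes_dyadic_le:
  assumes "n \<ge> 2"
  shows "(\<Sum>p | prime p \<and> n < p \<and> p \<le> 2 * n. 1 / real p) \<le> ln 4 / ln (real n)"
proof -
  let ?P = "{p. prime p \<and> n < p \<and> p \<le> 2 * n}"
  have fin: "finite ?P" by simp
  have "\<Prod>?P dvd ((2 * n) choose n)"
  proof (rule prod_primes_dvd)
    fix p assume p: "p \<in> ?P"
    have "\<not> p dvd fact n" using p by (simp add: prime_dvd_fact_iff)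
    moreover have "p dvd fact (2 * n)" using p by (simp add: prime_dvd_fact_iff)
    moreover have "fact (2 * n) = (fact n * fact n) * ((2 * n) choose n)"
      using binomial_fact_lemma[of n "2 * n"] by simp
    ultimately show "p dvd ((2 * n) choose n)" using p by (simp add: prime_dvd_mult_iff)
  qed auto
  then have "\<Prod>?P \<le> (2 * n) choose n" by (intro dvd_imp_le) auto
  also have "\<dots> \<le> 2 ^ (2 * n)" by (rule binomial_le_pow2)
  also have "\<dots> = 4 ^ n" by (simp add: power_mult)
  finally have "\<Prod>?P \<le> 4 ^ n" .
  moreover have "(\<Prod>p\<in>?P. n) \<le> \<Prod>?P" by (intro prod_mono) auto
  ultimately have "n ^ card ?P \<le> 4 ^ n" by simp
  then have "real (n ^ card ?P) \<le> real (4 ^ n)" by (simp only: of_nat_le_iff)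
  then have "real n ^ card ?P \<le> 4 ^ n" by simp
  then have "ln (real n ^ card ?P) \<le> ln (4 ^ n)" using assms by (subst ln_le_cancel_iff) auto
  then have *: "real (card ?P) * ln (real n) \<le> real n * ln 4" using assms by (simp add: ln_realpow)
  have "(\<Sum>p\<in>?P. 1 / real p) \<le> (\<Sum>p\<in>?P. 1 / real n)"
    using assms by (intro sum_mono) (auto simp: field_simps)
  also have "\<dots> \<le> ln 4 / ln (real n)" using * assms by (simp add: field_simps)
  finally show ?thesis .
qed

lemma sum_inverse_primes_pow2_le:
  assumes "k \<ge> 1"
  shows "(\<Sum>p | prime p \<and> 2 ^ k < p \<and> p \<le> 2 ^ Suc k. 1 / real p) \<le> 2 / real k"
proof -
  have "(2::nat) ^ 1 \<le> 2 ^ k" using assms by (intro power_increasing) auto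
  then have "(\<Sum>p | prime p \<and> 2 ^ k < p \<and> p \<le> 2 * 2 ^ k. 1 / real p) \<le> ln 4 / ln (real (2 ^ k))"
    by (intro sum_inverse_primes_dyadic_le) auto
  also have "ln (real (2 ^ k)) = real k * ln 2" by (simp add: ln_realpow)
  also have "ln (4::real) = 2 * ln 2" using ln_realpow[of "2::real" 2] by simp
  finally show ?thesis by simp
qed

text \<open>This is the integrality of \<open>Lcm {1..n}\<close> times the entries of Leibniz's harmonic triangle.\<close>
lemma binomial_times_dvd_Lcm:
  assumes "0 < m" "m \<le> n"
  shows "m * (n choose m) dvd Lcm {1..n}"
  using assms
proof (induction m arbitrary: n)
  case (Suc m)
  show ?case
  proof (cases "m = 0")
    case True
    then show ?thesis using Suc.prems by (auto intro: dvd_Lcm)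
  next
    case False
    obtain k where n: "n = Suc k" using Suc.prems by (cases n) auto
    have km: "m \<le> k" using Suc.prems n by auto
    have L: "Lcm {1..k} dvd Lcm {1..n}" using n by (intro Lcm_subset) auto
    have d1: "m * (k choose m) dvd Lcm {1..n}" using Suc.IH[of k] False km L by (auto intro: dvd_trans)
    have d2: "m * (n choose m) dvd Lcm {1..n}" using Suc.IH[of n] False Suc.prems by auto
    \<comment> \<open>The quotients of \<open>l\<close> by the two known multiples are
      \<open>c\<close> and \<open>d\<close>; their difference turns out to be the quotient by
      \<open>Suc m * (n choose Suc m)\<close>, which is therefore an integer.\<close>
    define l where "l = Lcm {1..n}"
    obtain c where c: "l = m * (k choose m) * c" using d1 unfolding l_def by blast
    obtain d where d: "l = m * (n choose m) * d" using d2 unfolding l_def by blast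
    have "(n - m) * (n choose m) = n * (k choose m)" using binomial_absorb_comp[of n m] n by simp
    moreover have "(k choose m) * c = (n choose m) * d" using c d False by simp
    ultimately have "(k choose m) * (c * (n - m)) = (k choose m) * (n * d)" by (metis mult.assoc mult.commute)
    then have "c * (n - m) = n * d" using km by simp
    then have "c * n - c * m = n * d" by (simp add: diff_mult_distrib2)
    moreover have "c * m \<le> c * n" using km n by (intro mult_le_mono2) simp
    ultimately have "c * n = c * m + n * d" by linarith
    then have "n * (c - d) = c * m" by (simp add: diff_mult_distrib2 mult.commute)
    then have "n * (k choose m) * (c - d) = l" using c by (simp add: mult_ac)
    moreover have "Suc m * (n choose Suc m) = n * (k choose m)"
      using Suc_times_binomial_eq[of k m] n by (simp add: mult_ac)
    ultimately show ?thesis by (metis dvd_triv_left l_def)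
  qed
qed simp


lemma prime_power_dvd_Lcm_imp_dvd:
  assumes "prime p" "finite A" "0 \<notin> A" "p ^ k dvd Lcm A" "k > 0"
  shows "\<exists>a\<in>A. p ^ k dvd (a::nat)"
  using assms(2-4)
proof (induction A rule: finite_induct)
  case empty
  then show ?case using assms by auto
next
  case (insert a A)
  have nz: "a \<noteq> 0" "Lcm A \<noteq> 0" using insert by (auto simp: Lcm_0_iff)
  have "multiplicity p (lcm a (Lcm A)) = max (multiplicity p a) (multiplicity p (Lcm A))"
    using nz assms(1) by (intro multiplicity_lcm) auto
  moreover have "k \<le> multiplicity p (lcm a (Lcm A))"
    using insert.prems nz assms(1) by (subst (asm) power_dvd_iff_le_multiplicity) auto
  ultimately have "p ^ k dvd a \<or> p ^ k dvd Lcm A"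
    by (metis le_max_iff_disj multiplicity_dvd')
  then show ?case using insert by auto
qed

text \<open>A prime power dividing the central binomial coefficient divides
  \<open>Lcm {1..2 * n}\<close>, hence some integer up to 2n, and so is itself at most 2n. The
  coefficient, at least 2^n, is then at most 2n to the number of primes up to 2n.\<close>

lemma card_primes_ge:
  assumes "n \<ge> 1"
  shows "real n * ln 2 \<le> real (card {p. prime p \<and> p \<le> 2 * n}) * ln (2 * real n)"
proof -
  define b where "b = (2 * n) choose n"
  have b0: "b > 0" by (simp add: b_def)
  have le: "p ^ multiplicity p b \<le> 2 * n" if "p \<in> prime_factors b" for p
  proof -
    have p: "prime p" "multiplicity p b > 0" using that by (auto simp: prime_factors_multiplicity)
    have "b dvd Lcm {1..2 * n}"
      using binomial_times_dvd_Lcm[of n "2 * n"] assms by (auto simp: b_def intro: dvd_trans[OF dvd_triv_right])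
    then have "p ^ multiplicity p b dvd Lcm {1..2 * n}" by (metis dvd_trans multiplicity_dvd)
    then have "\<exists>a\<in>{1..2 * n}. p ^ multiplicity p b dvd a"
      by (rule prime_power_dvd_Lcm_imp_dvd[OF p(1) _ _ _ p(2), rotated 2]) auto
    then obtain a where "a \<in> {1..2 * n}" "p ^ multiplicity p b dvd a" by blast
    then show ?thesis by (auto dest: dvd_imp_le)
  qed
  have sub: "prime_factors b \<subseteq> {p. prime p \<and> p \<le> 2 * n}"
  proof
    fix p assume p: "p \<in> prime_factors b"
    then have "p ^ 1 \<le> p ^ multiplicity p b"
      by (intro power_increasing) (auto simp: prime_factors_multiplicity Suc_le_eq prime_gt_0_nat)
    then show "p \<in> {p. prime p \<and> p \<le> 2 * n}" using le[OF p] p by auto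
  qed
  have "2 ^ n \<le> b"
  proof -
    have "(real (2 * n) / real n) ^ n \<le> real b"
      unfolding b_def using binomial_ge_n_over_k_pow_k[of n "2 * n", where ?'a = real] by simp
    then have "(2::real) ^ n \<le> real b" using assms by simp
    then show ?thesis by (metis of_nat_le_iff of_nat_numeral of_nat_power)
  qed
  also have "b = (\<Prod>p\<in>prime_factors b. p ^ multiplicity p b)"
    using b0 by (intro prime_factorization_nat)
  also have "\<dots> \<le> (\<Prod>p\<in>prime_factors b. 2 * n)" using le by (intro prod_mono) auto
  also have "\<dots> = (2 * n) ^ card (prime_factors b)" by simp
  also have "\<dots> \<le> (2 * n) ^ card {p. prime p \<and> p \<le> 2 * n}"
    using sub assms by (intro power_increasing card_mono) auto
  finally have "(2::real) ^ n \<le> (2 * real n) ^ card {p. prime p \<and> p \<le> 2 * n}"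
    by (metis (mono_tags, lifting) of_nat_le_iff of_nat_mult of_nat_numeral of_nat_power)
  then have "ln ((2::real) ^ n) \<le> ln ((2 * real n) ^ card {p. prime p \<and> p \<le> 2 * n})"
    using assms by (subst ln_le_cancel_iff) auto
  then show ?thesis using assms by (subst (asm) (1 2) ln_realpow) auto
qed

text \<open>Euler's argument: the harmonic sum is dominated by the product of 1 + 1 / (p - 1), hence
  by the exponential of the sum of 1 / (p - 1), and 1 / (p - 1) is at most 2 / p.\<close>

lemma ln_ln_le_sum_inverse_primes:
  assumes "v \<ge> 1"
  shows "ln (ln (real v + 1)) \<le> 2 * (\<Sum>p | prime p \<and> p \<le> v. 1 / real p)"
proof -
  let ?P = "{p. prime p \<and> p \<le> v}"
  have fin: "finite ?P" by simp
  have u: "1 / (real p - 1) \<ge> 0" "1 / (real p - 1) \<le> 2 * (1 / real p)" if "p \<in> ?P" for p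
    using that prime_ge_2_nat[of p] by (auto simp: field_simps)
  have "ln (real v + 1) \<le> harm v" by (rule ln_le_harm)
  also have "\<dots> \<le> (\<Sum>A\<in>bounded_subsets ?P v. \<Prod>p\<in>A. 1 / (real p - 1))"
    by (rule harm_le_sum_bounded_subsets)
  also have "\<dots> \<le> (\<Sum>A\<in>Pow ?P. \<Prod>p\<in>A. 1 / (real p - 1))"
    using u by (intro sum_mono2 prod_nonneg) (auto simp: bounded_subsets_def)
  also have "\<dots> = (\<Prod>p\<in>?P. 1 + 1 / (real p - 1))"
    using prod_add[OF fin, of "\<lambda>p. 1 / (real p - 1)" "\<lambda>_. 1"] by (simp add: add.commute)
  also have "\<dots> \<le> (\<Prod>p\<in>?P. exp (1 / (real p - 1)))"
    using u by (intro prod_mono) (auto intro: add_nonneg_nonneg)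
  also have "\<dots> = exp (\<Sum>p\<in>?P. 1 / (real p - 1))" by (simp add: exp_sum)
  finally have "ln (ln (real v + 1)) \<le> ln (exp (\<Sum>p\<in>?P. 1 / (real p - 1)))"
    using assms by (subst ln_le_cancel_iff) auto
  also have "\<dots> \<le> (\<Sum>p\<in>?P. 2 * (1 / real p))" unfolding ln_exp by (intro sum_mono u)
  finally show ?thesis by (simp add: sum_distrib_left)
qed

section \<open>Self-powers modulo a prime\<close>

lemma card_divisors_le_sqrt:
  assumes "n > 0"
  shows "real (card {d. d dvd n}) \<le> 2 * sqrt (real n)"
proof -
  define m where "m = nat \<lfloor>sqrt (real n)\<rfloor>"
  have m: "real m \<le> sqrt (real n)" "sqrt (real n) < real m + 1"
    unfolding m_def by (auto simp: of_nat_nat)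
  have "{d. d dvd n} \<subseteq> {1..m} \<union> (\<lambda>d. n div d) ` {1..m}"
  proof
    fix d assume "d \<in> {d. d dvd n}"
    then obtain e where e: "n = d * e" by auto
    then have de: "d > 0" "e > 0" using assms by auto
    have "d \<le> m \<or> e \<le> m"
    proof (rule ccontr)
      assume "\<not> (d \<le> m \<or> e \<le> m)"
      then have "sqrt (real n) < real d" "sqrt (real n) < real e" using m(2) by linarith+
      then have "sqrt (real n) * sqrt (real n) < real d * real e" using de by (intro mult_strict_mono) auto
      then show False using e by simp
    qed
    moreover have "d = n div e" using e de by simp
    ultimately show "d \<in> {1..m} \<union> (\<lambda>d. n div d) ` {1..m}" using de by (auto simp: image_iff Suc_le_eq)
  qed
  then have "card {d. d dvd n} \<le> card ({1..m} \<union> (\<lambda>d. n div d) ` {1..m})" by (intro card_mono) auto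
  also have "\<dots> \<le> card {1..m} + card ((\<lambda>d. n div d) ` {1..m})" by (rule card_Un_le)
  also have "\<dots> \<le> m + m" using card_image_le[of "{1..m}" "\<lambda>d. n div d"] by simp
  finally show ?thesis using m(1) by linarith
qed

text \<open>Two solutions agree modulo the order of \<open>x\<close>, and the order divides
  \<open>p - 1\<close>.\<close>

lemma card_exponents_le:
  fixes p x c :: nat
  assumes "prime p" "0 < x" "x < p"
  shows "card {y. y < p - 1 \<and> [x ^ y = c] (mod p)} \<le> (p - 1) div ord p x"
proof (cases "{y. y < p - 1 \<and> [x ^ y = c] (mod p)} = {}")
  case False
  let ?S = "{y. y < p - 1 \<and> [x ^ y = c] (mod p)}"
  let ?e = "ord p x"
  have cop: "coprime p x" using assms by (meson dvd_imp_le not_less prime_imp_coprime)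
  then have e0: "?e > 0" by simp
  have edvd: "?e dvd p - 1" using order_divides_totient[OF cop] totient_prime[OF assms(1)] by simp
  have eq: "y mod ?e = y' mod ?e" if "y \<in> ?S" "y' \<in> ?S" for y y'
  proof -
    have "[x ^ y = x ^ y'] (mod p)" using that by (auto intro: cong_trans cong_sym)
    then show ?thesis using order_divides_expdiff[OF cop] by (simp add: cong_def)
  qed
  have "inj_on (\<lambda>y. y div ?e) ?S"
  proof (rule inj_onI)
    fix y y' assume "y \<in> ?S" "y' \<in> ?S" and d: "y div ?e = y' div ?e"
    then have "y mod ?e = y' mod ?e" using eq by blast
    then have "y div ?e * ?e + y mod ?e = y' div ?e * ?e + y' mod ?e" by (simp only: d)
    then show "y = y'" by (simp only: div_mult_mod_eq)
  qed
  moreover have "(\<lambda>y. y div ?e) ` ?S \<subseteq> {..<(p - 1) div ?e}"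
    using edvd by (auto simp: less_mult_imp_div_less)
  ultimately have "card ?S \<le> card {..<(p - 1) div ?e}" by (intro card_inj_on_le) auto
  then show ?thesis by simp
next
  case True
  then show ?thesis by (simp only: card.empty)
qed

text \<open>At most \<open>d\<close> residues have order \<open>d\<close>, being roots of x^d = 1,
  and each admits at most (p - 1) / d exponents. Every divisor \<open>d\<close> of
  \<open>p - 1\<close> thus contributes at most \<open>p - 1\<close> pairs.\<close>

lemma card_power_pairs_le:
  fixes p c :: nat
  assumes "prime p"
  shows "card {(x, y). 0 < x \<and> x < p \<and> y < p - 1 \<and> [x ^ y = c] (mod p)} \<le> (p - 1) * card {d. d dvd p - 1}"
proof -
  let ?X = "{x. 0 < x \<and> x < p}" and ?D = "{d. d dvd p - 1}"
  have p1: "p - 1 > 0" using prime_gt_1_nat[OF assms] by simp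
  have S: "{(x, y). 0 < x \<and> x < p \<and> y < p - 1 \<and> [x ^ y = c] (mod p)}
    = Sigma ?X (\<lambda>x. {y. y < p - 1 \<and> [x ^ y = c] (mod p)})" by auto
  have "card {(x, y). 0 < x \<and> x < p \<and> y < p - 1 \<and> [x ^ y = c] (mod p)} = (\<Sum>x\<in>?X. card {y. y < p - 1 \<and> [x ^ y = c] (mod p)})"
    unfolding S
  proof (rule card_SigmaI)
    show "\<forall>x\<in>?X. finite {y. y < p - 1 \<and> [x ^ y = c] (mod p)}"
    proof
      show "finite {y. y < p - 1 \<and> [x ^ y = c] (mod p)}" for x
        by (rule finite_subset[of _ "{..<p - 1}"]) blast+
    qed
  qed simp
  also have "\<dots> \<le> (\<Sum>x\<in>?X. (p - 1) div ord p x)"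
  proof (rule sum_mono)
    fix x assume "x \<in> ?X"
    then have "0 < x" "x < p" by blast+
    then show "card {y. y < p - 1 \<and> [x ^ y = c] (mod p)} \<le> (p - 1) div ord p x"
      by (rule card_exponents_le[OF assms])
  qed
  also have "\<dots> = (\<Sum>d\<in>?D. \<Sum>x\<in>{x \<in> ?X. ord p x = d}. (p - 1) div ord p x)"
  proof (rule sum.group[symmetric])
    show "ord p ` ?X \<subseteq> ?D"
    proof clarify
      fix x assume "0 < x" "x < p"
      then have "coprime p x" using assms by (meson dvd_imp_le not_less prime_imp_coprime)
      then show "ord p x dvd p - 1" using order_divides_totient totient_prime[OF assms] by metis
    qed
  qed (use p1 in auto)
  also have "\<dots> \<le> (\<Sum>d\<in>?D. p - 1)"
  proof (rule sum_mono)
    fix d assume "d \<in> ?D"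
    then have d: "d dvd p - 1" "d > 0" using p1 by (auto intro: Nat.gr0I)
    have "card {x \<in> ?X. ord p x = d} \<le> card {x \<in> {..<p}. [x ^ d = 1] (mod p)}"
      using ord[of _ p] by (intro card_mono) auto
    also have "\<dots> \<le> d" using assms d by (intro roots_mod_prime_bound)
    finally have "card {x \<in> ?X. ord p x = d} * ((p - 1) div d) \<le> d * ((p - 1) div d)" by (rule mult_le_mono1)
    also have "d * ((p - 1) div d) = p - 1" using d by simp
    finally show "(\<Sum>x\<in>{x \<in> ?X. ord p x = d}. (p - 1) div ord p x) \<le> p - 1" by simp
  qed
  finally show ?thesis by (simp add: mult.commute)
qed

lemma card_residue_class_le:
  assumes "M > 0"
  shows "card {b. b \<le> A \<and> b mod M = r} \<le> A div M + (1::nat)"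
proof -
  have "inj_on (\<lambda>b. b div M) {b. b \<le> A \<and> b mod M = r}"
  proof (rule inj_onI)
    fix b b' assume "b \<in> {b. b \<le> A \<and> b mod M = r}" "b' \<in> {b. b \<le> A \<and> b mod M = r}" and d: "b div M = b' div M"
    then have "b mod M = r" "b' mod M = r" by blast+
    then have "b div M * M + b mod M = b' div M * M + b' mod M" by (simp only: d)
    then show "b = b'" by (simp only: div_mult_mod_eq)
  qed
  moreover have "(\<lambda>b. b div M) ` {b. b \<le> A \<and> b mod M = r} \<subseteq> {..A div M}"
    by (auto intro: div_le_mono)
  ultimately have "card {b. b \<le> A \<and> b mod M = r} \<le> card {..A div M}"
    by (intro card_inj_on_le) auto
  then show ?thesis by simp
qed

text \<open>For \<open>b\<close> prime to \<open>p\<close>, Fermat makes \<open>b ^ b\<close> depend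
  on \<open>b\<close> modulo \<open>p\<close> and modulo \<open>p - 1\<close>, and these residues
  are independent because the moduli are coprime. Of the p (p - 1) pairs at most 2 (p - 1) sqrt p
  are admissible, by the divisor bound; this gives 4 A / sqrt p, and the multiples of
  \<open>p\<close> add A / p.\<close>

theorem card_self_powers_le:
  fixes p c A :: nat
  assumes "prime p" "p\<^sup>2 \<le> A"
  shows "real (card {b \<in> {1..A}. [b ^ b = c] (mod p)}) \<le> 5 * real A / sqrt (real p)"
proof -
  let ?M = "p * (p - 1)"
  let ?S = "{(x, y). 0 < x \<and> x < p \<and> y < p - 1 \<and> [x ^ y = c] (mod p)}"
  let ?F = "\<lambda>(x, y). {b. b \<le> A \<and> b mod p = x \<and> b mod (p - 1) = y}"
  have p: "p > 1" using prime_gt_1_nat[OF assms(1)] .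
  have finS: "finite ?S" by (rule finite_subset[of _ "{..<p} \<times> {..<p - 1}"]) auto
  have cop: "coprime p (p - 1)" using p coprime_diff_one_right_nat[of p] by simp
  have "{b \<in> {1..A}. [b ^ b = c] (mod p)} \<subseteq> {b \<in> {1..A}. p dvd b} \<union> (\<Union>s\<in>?S. ?F s)"
  proof
    fix b assume b: "b \<in> {b \<in> {1..A}. [b ^ b = c] (mod p)}"
    show "b \<in> {b \<in> {1..A}. p dvd b} \<union> (\<Union>s\<in>?S. ?F s)"
    proof (cases "p dvd b")
      case False
      have "[b ^ (p - 1) = 1] (mod p)" using fermat_theorem[OF assms(1) False] .
      then have "[(b ^ (p - 1)) ^ (b div (p - 1)) * b ^ (b mod (p - 1)) = 1 ^ (b div (p - 1)) * b ^ (b mod (p - 1))] (mod p)"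
        by (intro cong_mult cong_pow cong_refl)
      then have "[b ^ b = b ^ (b mod (p - 1))] (mod p)"
        by (simp flip: power_mult power_add)
      moreover have "[b ^ (b mod (p - 1)) = (b mod p) ^ (b mod (p - 1))] (mod p)"
        by (intro cong_pow) (simp add: cong_def)
      ultimately have "[(b mod p) ^ (b mod (p - 1)) = c] (mod p)"
        using b by (metis (mono_tags, lifting) cong_sym cong_trans mem_Collect_eq)
      then have "(b mod p, b mod (p - 1)) \<in> ?S" using False p by (auto simp: mod_greater_zero_iff_not_dvd)
      moreover have "b \<in> ?F (b mod p, b mod (p - 1))" using b by auto
      ultimately show ?thesis by blast
    qed (use b in auto)
  qed
  then have "card {b \<in> {1..A}. [b ^ b = c] (mod p)} \<le> card ({b \<in> {1..A}. p dvd b} \<union> (\<Union>s\<in>?S. ?F s))"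
    using finS by (intro card_mono finite_UnI finite_UN_I) auto
  also have "\<dots> \<le> card {b \<in> {1..A}. p dvd b} + card (\<Union>s\<in>?S. ?F s)" by (rule card_Un_le)
  also have "card (\<Union>s\<in>?S. ?F s) \<le> (\<Sum>s\<in>?S. card (?F s))" using finS by (rule card_UN_le)
  also have "\<dots> \<le> (\<Sum>s\<in>?S. A div ?M + 1)"
  proof (rule sum_mono)
    fix s assume "s \<in> ?S"
    obtain x y where s: "s = (x, y)" by (cases s)
    show "card (?F s) \<le> A div ?M + 1"
    proof (cases "?F s = {}")
      case False
      then obtain b0 where b0: "b0 \<in> ?F s" by blast
      have "?F s \<subseteq> {b. b \<le> A \<and> b mod ?M = b0 mod ?M}"
      proof
        fix b assume b: "b \<in> ?F s"
        then have "[b = b0] (mod p)" "[b = b0] (mod (p - 1))" using b0 by (auto simp: s cong_def)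
        then have "[b = b0] (mod ?M)" using cop by (rule coprime_cong_mult_nat)
        then show "b \<in> {b. b \<le> A \<and> b mod ?M = b0 mod ?M}" using b by (auto simp: s cong_def)
      qed
      moreover have "finite {b. b \<le> A \<and> b mod ?M = b0 mod ?M}"
        by (rule finite_subset[of _ "{..A}"]) blast+
      ultimately have "card (?F s) \<le> card {b. b \<le> A \<and> b mod ?M = b0 mod ?M}" by (rule card_mono[rotated])
      also have "\<dots> \<le> A div ?M + 1" using p by (intro card_residue_class_le) auto
      finally show ?thesis .
    next
      case True
      then show ?thesis by (simp only: card.empty)
    qed
  qed
  also have "\<dots> = card ?S * (A div ?M + 1)" by simp
  also have "\<dots> \<le> ((p - 1) * card {d. d dvd p - 1}) * (A div ?M + 1)"
    using card_power_pairs_le[OF assms(1)] by (rule mult_le_mono1)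
  also have "card {b \<in> {1..A}. p dvd b} \<le> A div p"
  proof -
    have "{b \<in> {1..A}. p dvd b} \<subseteq> (\<lambda>k. p * k) ` {1..A div p}"
    proof clarify
      fix b assume b: "b \<in> {1..A}" "p dvd b"
      obtain k where k: "b = p * k" using b(2) by (rule dvdE)
      have "k * p \<le> A" "k > 0" using b(1) k by (auto simp: mult.commute)
      then have "k \<in> {1..A div p}" using p by (simp add: less_eq_div_iff_mult_less_eq)
      then show "b \<in> (\<lambda>k. p * k) ` {1..A div p}" using k by blast
    qed
    then have "card {b \<in> {1..A}. p dvd b} \<le> card ((\<lambda>k. p * k) ` {1..A div p})" by (intro card_mono) auto
    also have "\<dots> \<le> A div p" using card_image_le[of "{1..A div p}" "\<lambda>k. p * k"] by simp
    finally show ?thesis .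
  qed
  finally have "card {b \<in> {1..A}. [b ^ b = c] (mod p)} \<le> A div p + (p - 1) * card {d. d dvd p - 1} * (A div ?M + 1)"
    by simp
  then have "real (card {b \<in> {1..A}. [b ^ b = c] (mod p)}) \<le> real (A div p + (p - 1) * card {d. d dvd p - 1} * (A div ?M + 1))"
    by (simp only: of_nat_le_iff)
  also have "\<dots> = real (A div p) + real (p - 1) * real (card {d. d dvd p - 1}) * (real (A div ?M) + 1)"
    by (simp add: distrib_left)
  also have "\<dots> \<le> real A / real p + real (p - 1) * (2 * sqrt (real p)) * (real A / real ?M + real A / real ?M)"
  proof (intro add_mono mult_mono)
    show "real (A div p) \<le> real A / real p" "real (A div ?M) \<le> real A / real ?M" by (rule of_nat_div_le_of_nat)+
    have "real (card {d. d dvd p - 1}) \<le> 2 * sqrt (real (p - 1))" using p by (intro card_divisors_le_sqrt) auto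
    also have "\<dots> \<le> 2 * sqrt (real p)" by simp
    finally show "real (card {d. d dvd p - 1}) \<le> 2 * sqrt (real p)" .
    \<comment> \<open>A full period fits below \<open>A\<close>, so the rounding term 1 in each
      residue class costs only a factor 2.\<close>
    have "?M \<le> p * p" by (intro mult_le_mono) auto
    then have "real ?M \<le> real A" using assms(2) by (simp only: of_nat_le_iff power2_eq_square)
    then show "1 \<le> real A / real ?M" using p by (simp add: field_simps)
  qed auto
  also have "\<dots> = real A / real p + 4 * sqrt (real p) * (real A / real p)"
  proof -
    define a where "a = real A / real ?M"
    have "real (p - 1) * a = real A / real p" using p by (simp add: a_def)
    moreover have "real (p - 1) * (2 * sqrt (real p)) * (a + a) = 4 * sqrt (real p) * (real (p - 1) * a)" by simp
    ultimately show ?thesis by (simp only: a_def[symmetric])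
  qed
  also have "\<dots> \<le> 5 * real A / sqrt (real p)"
  proof -
    define s where "s = sqrt (real p)"
    have s: "s \<ge> 1" "real p = s * s" using p by (auto simp: s_def)
    have "real A / (s * s) + 4 * s * (real A / (s * s)) = (real A / s) * (1 / s + 4)"
      using s(1) by (simp add: field_simps)
    also have "\<dots> \<le> (real A / s) * (1 + 4)"
      using s(1) by (intro mult_left_mono add_right_mono) auto
    finally have "real A / real p + 4 * s * (real A / real p) \<le> (real A / s) * (1 + 4)" by (simp only: s(2))
    then show ?thesis by (simp add: s_def mult.commute)
  qed
  finally show ?thesis .
qed

section \<open>The singular product on average\<close>

text \<open>A bound for \<open>singular_product n h\<close> that is uniform in \<open>h\<close>. Its
  true order is (ln n)^2 by Mertens; a small power of \<open>n\<close> is enough here.\<close>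

definition prime_product :: "nat \<Rightarrow> real" where
  "prime_product n = (\<Prod>p | prime p \<and> p \<le> n. local_factor p)"

lemma inverse_pred_prime_le:
  assumes "prime p"
  shows "1 / (real p - 1) \<le> 2 / real p" "1 / (real p - 1) \<ge> 0"
  using prime_ge_2_nat[OF assms] by (auto simp: field_simps)

lemma local_factor_le_exp:
  assumes "prime p"
  shows "local_factor p \<le> exp (2 * (1 / (real p - 1)))"
proof -
  have "(1 + 1 / (real p - 1))\<^sup>2 \<le> (exp (1 / (real p - 1)))\<^sup>2"
    using inverse_pred_prime_le[OF assms] by (intro power_mono exp_ge_add_one_self) auto
  also have "\<dots> = exp (2 * (1 / (real p - 1)))"
    by (rule exp_double[symmetric])
  finally show ?thesis by (simp only: local_factor_def)
qed

lemma local_factor_minus_1_le: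
  assumes "prime p"
  shows "local_factor p - 1 \<le> 6 / real p"
proof -
  define t where "t = 1 / (real p - 1)"
  have t: "t \<ge> 0" "t \<le> 1" "t \<le> 2 / real p"
    using inverse_pred_prime_le[OF assms] prime_ge_2_nat[OF assms] by (auto simp: t_def)
  have "local_factor p - 1 = t * (2 + t)"
    unfolding local_factor_def t_def[symmetric] by (simp add: power2_eq_square algebra_simps)
  also have "\<dots> \<le> (2 / real p) * 3" using t by (intro mult_mono) auto
  finally show ?thesis by simp
qed

lemma prod_local_factor_le_exp:
  assumes "finite S" "\<And>p. p \<in> S \<Longrightarrow> prime p"
  shows "(\<Prod>p\<in>S. local_factor p) \<le> exp (4 * (\<Sum>p\<in>S. 1 / real p))"
proof -
  have "(\<Prod>p\<in>S. local_factor p) \<le> (\<Prod>p\<in>S. exp (4 * (1 / real p)))"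
  proof (intro prod_mono conjI)
    fix p assume "p \<in> S"
    then have p: "prime p" using assms by blast
    show "0 \<le> local_factor p" using local_factor_bounds[OF p] by simp
    have "2 * (1 / (real p - 1)) \<le> 4 * (1 / real p)" using inverse_pred_prime_le[OF p] by simp
    then show "local_factor p \<le> exp (4 * (1 / real p))"
      using local_factor_le_exp[OF p] by (meson exp_le_cancel_iff order_trans)
  qed
  also have "\<dots> = exp (4 * (\<Sum>p\<in>S. 1 / real p))"
    using assms(1) by (simp add: exp_sum sum_distrib_left)
  finally show ?thesis .
qed

lemma prime_product_mono:
  assumes "m \<le> n"
  shows "prime_product m \<le> prime_product n"
  unfolding prime_product_def using assms local_factor_bounds
  by (intro prod_mono2) (auto intro: order_trans[OF zero_le_one])

lemma prime_product_ge_1: "prime_product n \<ge> 1"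
  unfolding prime_product_def using local_factor_bounds by (intro prod_ge_1) auto

lemma prime_product_double_le:
  assumes "k \<ge> 1"
  shows "prime_product (2 ^ Suc k) \<le> prime_product (2 ^ k) * exp (8 / real k)"
proof -
  let ?S = "{p. prime p \<and> 2 ^ k < p \<and> p \<le> 2 ^ Suc k}"
  have le: "(2::nat) ^ k \<le> 2 ^ Suc k" by simp
  have "{p::nat. prime p \<and> p \<le> 2 ^ Suc k} = {p. prime p \<and> p \<le> 2 ^ k} \<union> ?S"
    by (auto simp del: power_Suc intro: order_trans[OF _ le])
  then have "prime_product (2 ^ Suc k) = prime_product (2 ^ k) * (\<Prod>p\<in>?S. local_factor p)"
    unfolding prime_product_def by (simp only:) (intro prod.union_disjoint; auto)
  also have "(\<Prod>p\<in>?S. local_factor p) \<le> exp (4 * (\<Sum>p\<in>?S. 1 / real p))"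
    by (rule prod_local_factor_le_exp) auto
  also have "\<dots> \<le> exp (4 * (2 / real k))"
    using sum_inverse_primes_pow2_le[OF assms] by (simp only: exp_le_cancel_iff mult_le_cancel_left_pos zero_less_numeral)
  finally show ?thesis using prime_product_ge_1[of "2 ^ k"] by (simp add: mult_left_mono)
qed

text \<open>Doubling the range costs a factor exp (8 / k), which is at most 2^(1/4) once
  \<open>k\<close> reaches 64, as 64 * (2 / 3) exceeds 32; smaller \<open>k\<close> go into the
  constant. Any exponent below 1/2 in place of 1/4 would keep the later series convergent.\<close>

lemma prime_product_pow2_le:
  "prime_product (2 ^ k) \<le> prime_product (2 ^ 64) * 2 powr (real k / 4)"
proof (induction k)
  case 0
  show ?case using prime_product_mono[of 1 "2 ^ 64"] by simp
next
  case (Suc k)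
  show ?case
  proof (cases "Suc k \<le> 64")
    case True
    then have "(2::nat) ^ Suc k \<le> 2 ^ 64" by (intro power_increasing) auto
    then have "prime_product (2 ^ Suc k) \<le> prime_product (2 ^ 64) * 1"
      by (simp only: mult_1_right prime_product_mono)
    also have "\<dots> \<le> prime_product (2 ^ 64) * 2 powr (real (Suc k) / 4)"
      using prime_product_ge_1[of "2 ^ 64"] by (intro mult_left_mono ge_one_powr_ge_zero) auto
    finally show ?thesis .
  next
    case False
    then have k: "k \<ge> 64" by simp
    have "64 * (2 / 3) \<le> real k * ln 2" using k ln2_ge_two_thirds by (intro mult_mono) auto
    then have "8 / real k \<le> ln 2 / 4" using k by (simp add: field_simps)
    then have e: "exp (8 / real k) \<le> 2 powr (1 / 4)" by (simp add: powr_def)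
    have "prime_product (2 ^ Suc k) \<le> prime_product (2 ^ k) * exp (8 / real k)"
      using k by (intro prime_product_double_le) simp
    also have "\<dots> \<le> (prime_product (2 ^ 64) * 2 powr (real k / 4)) * 2 powr (1 / 4)"
      using Suc.IH e prime_product_ge_1[of "2 ^ 64"] by (intro mult_mono) auto
    also have "\<dots> = prime_product (2 ^ 64) * 2 powr (real (Suc k) / 4)"
      by (simp add: powr_add[symmetric] add_divide_distrib add.commute)
    finally show ?thesis .
  qed
qed

lemma ex_pow2_interval:
  assumes "n \<ge> (1::nat)"
  obtains k where "2 ^ k \<le> n" "n < 2 ^ Suc k"
proof -
  have "\<exists>k. 2 ^ k \<le> n \<and> n < 2 ^ (k + 1)" using ex_power_ivl1[of 2 n] assms by simp
  then show ?thesis using that by auto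
qed

lemma prime_product_le_powr:
  assumes "n \<ge> 1"
  shows "prime_product n \<le> 2 * prime_product (2 ^ 64) * real n powr (1 / 4)"
proof -
  obtain k where k: "2 ^ k \<le> n" "n < 2 ^ Suc k" using ex_pow2_interval[OF assms] .
  have "prime_product n \<le> prime_product (2 ^ Suc k)" using k by (intro prime_product_mono) simp
  also have "\<dots> \<le> prime_product (2 ^ 64) * 2 powr (real (Suc k) / 4)" by (rule prime_product_pow2_le)
  also have "2 powr (real (Suc k) / 4) = 2 powr (1 / 4) * (2 powr real k) powr (1 / 4)"
    by (simp add: powr_add[symmetric] powr_powr add_divide_distrib)
  also have "\<dots> \<le> 2 * real n powr (1 / 4)"
  proof (intro mult_mono powr_mono2)
    show "(2::real) powr (1 / 4) \<le> 2" using powr_mono[of "1 / 4" 1 "2::real"] by simp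
    have "real (2 ^ k) \<le> real n" using k(1) by (simp only: of_nat_le_iff)
    then show "2 powr real k \<le> real n" by (simp add: powr_realpow)
  qed auto
  finally show ?thesis using prime_product_ge_1[of "2 ^ 64"] by (simp add: mult_ac)
qed

lemma singular_product_le_prime_product: "singular_product n h \<le> prime_product n"
  unfolding singular_product_def prime_product_def using local_factor_bounds
  by (intro prod_mono2) (auto intro: order_trans[OF zero_le_one])

text \<open>Adding a prime \<open>p\<close> that divides \<open>h\<close> increases the product by
  \<open>local_factor p - 1\<close> times the product over smaller primes, and the latter is
  replaced by its bound without reference to \<open>h\<close>. What remains is linear in the
  conditions \<open>p dvd h\<close>, so it can be averaged one prime at a time.\<close>

lemma singular_product_telescope:
  "singular_product n h \<le> 1 + (\<Sum>p | prime p \<and> p \<le> n. if p dvd h then 6 / real p * prime_product p else 0)"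
proof (induction n)
  case 0
  have "{p. prime p \<and> p \<le> 0 \<and> p dvd h} = {}" "{p::nat. prime p \<and> p \<le> 0} = {}" by auto
  then show ?case by (simp only: singular_product_def) simp
next
  case (Suc n)
  let ?S = "\<lambda>n. \<Sum>p | prime p \<and> p \<le> n. if p dvd h then 6 / real p * prime_product p else 0"
  show ?case
  proof (cases "prime (Suc n)")
    case p: True
    have 1: "{p. prime p \<and> p \<le> Suc n} = insert (Suc n) {p. prime p \<and> p \<le> n}" using p by (auto simp: le_Suc_eq)
    have S: "?S (Suc n) = ?S n + (if Suc n dvd h then 6 / real (Suc n) * prime_product (Suc n) else 0)"
      unfolding 1 by (subst sum.insert) auto
    show ?thesis
    proof (cases "Suc n dvd h")
      case True
      have "{p. prime p \<and> p \<le> Suc n \<and> p dvd h} = insert (Suc n) {p. prime p \<and> p \<le> n \<and> p dvd h}"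
        using p True by (auto simp: le_Suc_eq)
      then have "singular_product (Suc n) h = local_factor (Suc n) * singular_product n h"
        unfolding singular_product_def by (simp only:) (subst prod.insert; auto)
      also have "\<dots> = singular_product n h + (local_factor (Suc n) - 1) * singular_product n h"
        by (simp add: algebra_simps)
      also have "\<dots> \<le> (1 + ?S n) + 6 / real (Suc n) * prime_product (Suc n)"
        using Suc.IH local_factor_minus_1_le[OF p] singular_product_ge_1[of n h]
          order_trans[OF singular_product_le_prime_product prime_product_mono[of n "Suc n"]]
        by (intro add_mono mult_mono) auto
      finally show ?thesis unfolding S using True by (simp only: if_True add.assoc)
    next
      case False
      then have "{p. prime p \<and> p \<le> Suc n \<and> p dvd h} = {p. prime p \<and> p \<le> n \<and> p dvd h}" by (auto simp: le_Suc_eq)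
      then have "singular_product (Suc n) h = singular_product n h" by (simp only: singular_product_def)
      then show ?thesis unfolding S using False Suc.IH by simp
    qed
  next
    case False
    then have "{p. prime p \<and> p \<le> Suc n \<and> p dvd h} = {p. prime p \<and> p \<le> n \<and> p dvd h}"
      "{p. prime p \<and> p \<le> Suc n} = {p. prime p \<and> p \<le> n}" by (auto simp: le_Suc_eq)
    then show ?thesis using Suc.IH by (simp only: singular_product_def)
  qed
qed


section \<open>Bounding the contribution of larger primes pointwise\<close>

lemma sum_UN_le:
  fixes f :: "'b \<Rightarrow> real"
  assumes "finite J" "\<And>j. j \<in> J \<Longrightarrow> finite (S j)" "\<And>x. f x \<ge> 0"
  shows "sum f (\<Union>j\<in>J. S j) \<le> (\<Sum>j\<in>J. sum f (S j))"
  using assms(1,2)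
proof (induction J rule: finite_induct)
  case (insert j J)
  have "sum f (S j \<union> (\<Union>i\<in>J. S i)) + sum f (S j \<inter> (\<Union>i\<in>J. S i)) = sum f (S j) + sum f (\<Union>i\<in>J. S i)"
    using insert by (intro sum.union_inter) auto
  moreover have "sum f (S j \<inter> (\<Union>i\<in>J. S i)) \<ge> 0" using assms(3) by (rule sum_nonneg)
  ultimately have "sum f (S j \<union> (\<Union>i\<in>J. S i)) \<le> sum f (S j) + (\<Sum>i\<in>J. sum f (S i))"
    using insert by simp
  then show ?case using insert by simp
qed simp

lemma card_prime_divisors_le:
  fixes h :: nat
  assumes "0 < h" "h \<le> 2 ^ m"
  shows "card {p. prime p \<and> p dvd h} \<le> m"
proof -
  let ?P = "{p. prime p \<and> p dvd h}"
  have fin: "finite ?P" by (rule finite_subset[of _ "{..h}"]) (use assms(1) in \<open>auto dest: dvd_imp_le\<close>)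
  have "2 ^ card ?P = (\<Prod>p\<in>?P. 2::nat)" by simp
  also have "\<dots> \<le> \<Prod>?P" by (intro prod_mono) (auto intro: prime_ge_2_nat)
  also have "\<dots> \<le> h" using fin assms(1) by (intro dvd_imp_le prod_primes_dvd) auto
  also have "\<dots> \<le> 2 ^ m" by (rule assms(2))
  finally show ?thesis by simp
qed

text \<open>At most \<open>m\<close> primes divide \<open>h\<close>, and each one above
  \<open>m\<close> contributes at most exp (2 / m).\<close>

lemma prod_large_local_factors_le:
  assumes "0 < h" "h \<le> 2 ^ m" "m > 0"
  shows "(\<Prod>p | prime p \<and> p dvd h \<and> m < p. local_factor p) \<le> exp 2"
proof -
  let ?P = "{p. prime p \<and> p dvd h}" and ?L = "{p. prime p \<and> p dvd h \<and> m < p}"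
  have fin: "finite ?P" by (rule finite_subset[of _ "{..h}"]) (use assms(1) in \<open>auto dest: dvd_imp_le\<close>)
  have "(\<Prod>p\<in>?L. local_factor p) \<le> (\<Prod>p\<in>?L. exp (2 / real m))"
  proof (intro prod_mono conjI)
    fix p assume p: "p \<in> ?L"
    then have "real m \<le> real p - 1" by auto
    then have "2 * (1 / (real p - 1)) \<le> 2 / real m" using assms(3) by (simp add: frac_le)
    then have "exp (2 * (1 / (real p - 1))) \<le> exp (2 / real m)" by (simp only: exp_le_cancel_iff)
    moreover have "local_factor p \<le> exp (2 * (1 / (real p - 1)))" using p local_factor_le_exp by blast
    ultimately show "local_factor p \<le> exp (2 / real m)" by (rule order_trans[rotated])
    show "0 \<le> local_factor p" using p local_factor_bounds[of p] by auto
  qed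
  also have "\<dots> = exp (real (card ?L) * (2 / real m))" by (simp only: prod_constant exp_of_nat_mult)
  also have "\<dots> \<le> exp 2"
  proof -
    have "card ?L \<le> card ?P" using fin by (intro card_mono) auto
    then have "real (card ?L) \<le> real m" using card_prime_divisors_le[OF assms(1,2)] by simp
    then show ?thesis using assms(3) by (simp add: field_simps)
  qed
  finally show ?thesis .
qed

text \<open>The range from \<open>y\<close> to its fourth power meets at most 3 k + 4 dyadic blocks,
  each with reciprocal sum at most 2 / k. The total is at most 14, and the local factors turn it
  into exp (4 * 14).\<close>

lemma prod_medium_local_factors_le:
  assumes "y \<ge> 1" "m < (y + 1) ^ 4"
  shows "(\<Prod>p | prime p \<and> y < p \<and> p \<le> m. local_factor p) \<le> exp 56"
proof -
  obtain k where k: "2 ^ k \<le> y" "y < 2 ^ Suc k" using ex_pow2_interval[OF assms(1)] .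
  have "(y + 1) ^ 4 \<le> (2 ^ Suc k) ^ 4" using k(2) by (intro power_mono) auto
  also have "\<dots> = 2 ^ (4 * k + 4)" by (simp add: power_mult[symmetric] algebra_simps del: power_Suc)
  finally have m: "m < 2 ^ (4 * k + 4)" using assms(2) by linarith
  let ?S = "\<lambda>j. {p. prime p \<and> 2 ^ j < p \<and> p \<le> 2 ^ Suc j}"
  let ?J = "{k..<4 * k + 4}"
  let ?M = "{p. prime p \<and> y < p \<and> p \<le> m}"
  \<comment> \<open>The maximum covers \<open>k = 0\<close>: the block \<open>j = 0\<close>, which
    occurs only then, consists of the prime 2 alone.\<close>
  have dy: "(\<Sum>p\<in>?S j. 1 / real p) \<le> 2 / max 1 (real k)" if "j \<in> ?J" for j
  proof (cases "j = 0")
    case True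
    then have "?S j = {2::nat}" by (auto dest: prime_ge_2_nat)
    then show ?thesis using True that by simp
  next
    case False
    then have "(\<Sum>p\<in>?S j. 1 / real p) \<le> 2 / real j" by (intro sum_inverse_primes_pow2_le) simp
    also have "\<dots> \<le> 2 / max 1 (real k)" using False that by (intro divide_left_mono) auto
    finally show ?thesis .
  qed
  have sub: "?M \<subseteq> (\<Union>j\<in>?J. ?S j)"
  proof
    fix p assume p: "p \<in> ?M"
    \<comment> \<open>The blocks exclude their left end and include their right end, so the
      bracketing power of 2 is taken for \<open>p - 1\<close>.\<close>
    then have "p - 1 \<ge> 1" by (auto dest: prime_ge_2_nat)
    then obtain j where j: "2 ^ j \<le> p - 1" "p - 1 < 2 ^ Suc j" using ex_pow2_interval by blast
    have "j < 4 * k + 4"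
    proof -
      have "p \<le> m" using p by blast
      then have "(2::nat) ^ j < 2 ^ (4 * k + 4)" using j(1) m by linarith
      then show ?thesis by (rule power_less_imp_less_exp[rotated]) simp
    qed
    moreover have "k < Suc j"
    proof -
      have "y \<le> p - 1" using p by auto
      then have "(2::nat) ^ k < 2 ^ Suc j" using j(2) k(1) by linarith
      then show ?thesis by (rule power_less_imp_less_exp[rotated]) simp
    qed
    ultimately have "j \<in> ?J" by simp
    moreover have "2 ^ j < p" "p \<le> 2 ^ Suc j" using j \<open>p - 1 \<ge> 1\<close> by linarith+
    then have "p \<in> ?S j" using p by blast
    ultimately show "p \<in> (\<Union>j\<in>?J. ?S j)" by blast
  qed
  have "(\<Sum>p\<in>?M. 1 / real p) \<le> (\<Sum>p\<in>(\<Union>j\<in>?J. ?S j). 1 / real p)"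
    using sub by (intro sum_mono2) auto
  also have "\<dots> \<le> (\<Sum>j\<in>?J. \<Sum>p\<in>?S j. 1 / real p)"
    by (rule sum_UN_le) auto
  also have "\<dots> \<le> (\<Sum>j\<in>?J. 2 / max 1 (real k))" by (intro sum_mono dy)
  also have "\<dots> = (3 * real k + 4) * (2 / max 1 (real k))" by simp
  also have "\<dots> \<le> 14" by (auto simp: max_def field_simps)
  finally have s: "(\<Sum>p\<in>?M. 1 / real p) \<le> 14" .
  have "(\<Prod>p\<in>?M. local_factor p) \<le> exp (4 * (\<Sum>p\<in>?M. 1 / real p))"
    by (rule prod_local_factor_le_exp) auto
  also have "\<dots> \<le> exp 56" using s by simp
  finally show ?thesis .
qed

text \<open>Primes in (y, m] cost exp 56 and prime divisors of \<open>h\<close> above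
  \<open>m\<close> cost exp 2. In the application \<open>m\<close> is A^2 and \<open>y\<close> the
  integer part of sqrt A, whence the fourth power in the hypothesis.\<close>

lemma singular_product_truncate:
  assumes "0 < h" "h \<le> 2 ^ m" "m > 0" "y \<ge> 1" "m < (y + 1) ^ 4"
  shows "singular_product v h \<le> singular_product y h * exp 58"
proof -
  let ?Y = "{p. prime p \<and> p \<le> y \<and> p dvd h}"
  let ?M = "{p. prime p \<and> y < p \<and> p \<le> m}"
  let ?L = "{p. prime p \<and> p dvd h \<and> m < p}"
  have fin: "finite ?Y" "finite ?M" by auto
  have "finite ?L" by (rule finite_subset[of _ "{..h}"]) (use assms(1) in \<open>auto dest: dvd_imp_le\<close>)
  note fin = fin this
  have le1: "(\<Prod>p\<in>S \<union> T. local_factor p) \<le> (\<Prod>p\<in>S. local_factor p) * (\<Prod>p\<in>T. local_factor p)"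
    if "finite S" "finite T" "\<And>p. p \<in> S \<union> T \<Longrightarrow> prime p" for S T
  proof -
    have "(\<Prod>p\<in>S \<union> T. local_factor p) * 1 \<le> (\<Prod>p\<in>S \<union> T. local_factor p) * (\<Prod>p\<in>S \<inter> T. local_factor p)"
      using that local_factor_bounds by (intro mult_left_mono prod_ge_1 prod_nonneg) (auto intro: order_trans[OF zero_le_one])
    then show ?thesis using prod.union_inter[OF that(1,2), of local_factor] by simp
  qed
  have "singular_product v h \<le> (\<Prod>p\<in>?Y \<union> (?M \<union> ?L). local_factor p)"
    unfolding singular_product_def using fin local_factor_bounds
    by (intro prod_mono2) (auto intro: order_trans[OF zero_le_one])
  also have "\<dots> \<le> (\<Prod>p\<in>?Y. local_factor p) * (\<Prod>p\<in>?M \<union> ?L. local_factor p)"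
    using fin by (intro le1) auto
  also have "\<dots> \<le> (\<Prod>p\<in>?Y. local_factor p) * (exp 56 * exp 2)"
  proof (intro mult_left_mono)
    have "(\<Prod>p\<in>?M \<union> ?L. local_factor p) \<le> (\<Prod>p\<in>?M. local_factor p) * (\<Prod>p\<in>?L. local_factor p)"
      using fin by (intro le1) auto
    also have "\<dots> \<le> exp 56 * exp 2"
      using prod_medium_local_factors_le[OF assms(4,5)] prod_large_local_factors_le[OF assms(1-3)] local_factor_bounds
      by (intro mult_mono prod_nonneg) (auto intro: order_trans[OF zero_le_one])
    finally show "(\<Prod>p\<in>?M \<union> ?L. local_factor p) \<le> exp 56 * exp 2" .
    show "0 \<le> (\<Prod>p\<in>?Y. local_factor p)" using singular_product_ge_1[of y h] by (simp add: singular_product_def)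
  qed
  finally show ?thesis by (simp add: singular_product_def exp_add[symmetric])
qed

text \<open>Romanoff's average for self-powers. The constant must not depend on \<open>v\<close>,
  because the sieve level grows with \<open>N\<close>.\<close>

theorem sum_singular_product_self_powers_le:
  "\<exists>C>0. \<forall>A v. A \<ge> 1 \<longrightarrow>
    (\<Sum>a=1..A. \<Sum>b\<in>{a<..A}. singular_product v (b ^ b - a ^ a)) \<le> C * (real A)\<^sup>2"
proof -
  define C0 where "C0 = 2 * prime_product (2 ^ 64)"
  have C0: "C0 > 0" using prime_product_ge_1[of "2 ^ 64"] by (simp add: C0_def)
  define K where "K = (\<Sum>n. real n powr (-5 / 4))"
  have summ: "summable (\<lambda>n. real n powr (-5 / 4))" by (subst summable_real_powr_iff) simp
  have K0: "K \<ge> 0" unfolding K_def by (intro suminf_nonneg summ) simp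
  define C where "C = exp 58 * (1 + 30 * C0 * K)"
  have "C > 0" unfolding C_def using C0 K0 by (intro mult_pos_pos add_pos_nonneg mult_nonneg_nonneg) auto
  moreover have "(\<Sum>a=1..A. \<Sum>b\<in>{a<..A}. singular_product v (b ^ b - a ^ a)) \<le> C * (real A)\<^sup>2" if A: "A \<ge> 1" for A v
  proof -
    \<comment> \<open>The largest range of primes \<open>p\<close> with p^2 at most
      \<open>A\<close>, as the count of self-powers in a residue class requires.\<close>
    define y where "y = nat \<lfloor>sqrt (real A)\<rfloor>"
    have y: "real y \<le> sqrt (real A)" "sqrt (real A) < real y + 1" "y \<ge> 1"
      using A unfolding y_def by (auto simp: of_nat_nat le_nat_iff le_floor_iff)
    have "(real y)\<^sup>2 \<le> (sqrt (real A))\<^sup>2" using y by (intro power_mono) auto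
    then have y2: "y\<^sup>2 \<le> A" by (simp flip: of_nat_power)
    have "(sqrt (real A))\<^sup>2 < (real y + 1)\<^sup>2" using y by (intro power_strict_mono) auto
    then have "real A < real ((y + 1)\<^sup>2)" by (simp add: add.commute)
    then have "A < (y + 1)\<^sup>2" by (simp only: of_nat_less_iff)
    then have "A * A < (y + 1)\<^sup>2 * (y + 1)\<^sup>2" by (intro mult_strict_mono) auto
    then have y4: "A * A < (y + 1) ^ 4" by (simp flip: power_add)
    define g where "g p = 6 / real p * prime_product p" for p
    let ?P = "{p. prime p \<and> p \<le> y}"
    have "(\<Sum>a=1..A. \<Sum>b\<in>{a<..A}. singular_product v (b ^ b - a ^ a))
      \<le> (\<Sum>a=1..A. \<Sum>b\<in>{a<..A}. (1 + (\<Sum>p\<in>?P. if p dvd b ^ b - a ^ a then g p else 0)) * exp 58)"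
    proof (intro sum_mono)
      fix a b assume ab: "a \<in> {1..A}" "b \<in> {a<..A}"
      have "a ^ a < b ^ a" using ab by (intro power_strict_mono) auto
      also have "b ^ a \<le> b ^ b" using ab by (intro power_increasing) auto
      finally have pos: "0 < b ^ b - a ^ a" by simp
      have "b ^ b - a ^ a \<le> b ^ b" by simp
      also have "\<dots> \<le> (2 ^ A) ^ b"
      proof (rule power_mono)
        have "(2::nat) ^ b \<le> 2 ^ A" using ab by (intro power_increasing) auto
        then show "b \<le> 2 ^ A" using less_exp[of b] by linarith
      qed simp
      also have "\<dots> \<le> (2 ^ A) ^ A" using ab by (intro power_increasing) auto
      also have "\<dots> = 2 ^ (A * A)" by (simp add: power_mult)
      finally have "singular_product v (b ^ b - a ^ a) \<le> singular_product y (b ^ b - a ^ a) * exp 58"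
        using pos A y(3) y4 by (intro singular_product_truncate[of _ "A * A"]) auto
      also have "\<dots> \<le> (1 + (\<Sum>p\<in>?P. if p dvd b ^ b - a ^ a then g p else 0)) * exp 58"
        unfolding g_def by (intro mult_right_mono singular_product_telescope) auto
      finally show "singular_product v (b ^ b - a ^ a) \<le> (1 + (\<Sum>p\<in>?P. if p dvd b ^ b - a ^ a then g p else 0)) * exp 58" .
    qed
    also have "\<dots> = ((\<Sum>a=1..A. \<Sum>b\<in>{a<..A}. 1) + (\<Sum>a=1..A. \<Sum>b\<in>{a<..A}. \<Sum>p\<in>?P. if p dvd b ^ b - a ^ a then g p else 0)) * exp 58"
      by (simp only: sum_distrib_right[symmetric] sum.distrib)
    also have "\<dots> \<le> ((real A)\<^sup>2 + 30 * C0 * K * (real A)\<^sup>2) * exp 58"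
    proof (intro mult_right_mono add_mono)
      have "(\<Sum>a=1..A. \<Sum>b\<in>{a<..A}. 1 :: real) \<le> (\<Sum>a=1..A. real A)" by (intro sum_mono) simp
      then show "(\<Sum>a=1..A. \<Sum>b\<in>{a<..A}. 1) \<le> (real A)\<^sup>2" by (simp add: power2_eq_square)
      have g0: "g p \<ge> 0" for p using prime_product_ge_1[of p] by (simp add: g_def)
      have inner: "(\<Sum>a=1..A. \<Sum>b\<in>{a<..A}. if p dvd b ^ b - a ^ a then g p else 0)
        \<le> 30 * C0 * (real A)\<^sup>2 * real p powr (-5 / 4)" if p: "p \<in> ?P" for p
      proof -
        have pp: "prime p" "p \<le> y" "p > 0" using p prime_gt_0_nat by auto
        have "p\<^sup>2 \<le> y\<^sup>2" using pp by (intro power_mono) auto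
        then have pA: "p\<^sup>2 \<le> A" using y2 by linarith
        have "(\<Sum>a=1..A. \<Sum>b\<in>{a<..A}. if p dvd b ^ b - a ^ a then g p else 0)
          \<le> (\<Sum>a=1..A. g p * (5 * real A / sqrt (real p)))"
        proof (rule sum_mono)
          fix a assume a: "a \<in> {1..A}"
          have "(\<Sum>b\<in>{a<..A}. if p dvd b ^ b - a ^ a then g p else 0) = (\<Sum>b\<in>{b \<in> {a<..A}. p dvd b ^ b - a ^ a}. g p)"
            by (rule sum.inter_filter[symmetric]) simp
          also have "\<dots> = g p * real (card {b \<in> {a<..A}. p dvd b ^ b - a ^ a})" by simp
          also have "\<dots> \<le> g p * real (card {b \<in> {1..A}. [b ^ b = a ^ a] (mod p)})"
          proof (intro mult_left_mono g0 of_nat_mono card_mono)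
            show "{b \<in> {a<..A}. p dvd b ^ b - a ^ a} \<subseteq> {b \<in> {1..A}. [b ^ b = a ^ a] (mod p)}"
            proof clarify
              fix b assume b: "b \<in> {a<..A}" "p dvd b ^ b - a ^ a"
              have "a ^ a \<le> b ^ a" using b by (intro power_mono) auto
              also have "b ^ a \<le> b ^ b" using b by (intro power_increasing) auto
              finally have "[b ^ b = a ^ a] (mod p)" using b(2) by (simp add: cong_altdef_nat)
              then show "b \<in> {1..A} \<and> [b ^ b = a ^ a] (mod p)" using b a by auto
            qed
          qed simp
          also have "\<dots> \<le> g p * (5 * real A / sqrt (real p))"
            by (intro mult_left_mono g0 card_self_powers_le pp pA)
          finally show "(\<Sum>b\<in>{a<..A}. if p dvd b ^ b - a ^ a then g p else 0) \<le> g p * (5 * real A / sqrt (real p))" .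
        qed
        also have "\<dots> = 5 * (real A)\<^sup>2 * (g p / sqrt (real p))" by (simp add: power2_eq_square)
        also have "\<dots> \<le> 5 * (real A)\<^sup>2 * (6 * C0 * real p powr (-5 / 4))"
        proof (rule mult_left_mono)
          \<comment> \<open>The exponents combine as 1/4 - 1 - 1/2 = -5/4; together with the factor
            5 from the residue count, the 6 gives the constant 30.\<close>
          have "g p \<le> 6 / real p * (C0 * real p powr (1 / 4))"
            unfolding g_def C0_def using pp by (intro mult_left_mono prime_product_le_powr) auto
          then have "g p / sqrt (real p) \<le> 6 / real p * (C0 * real p powr (1 / 4)) / sqrt (real p)"
            by (intro divide_right_mono) auto
          also have "\<dots> = 6 * C0 * (real p powr (1 / 4) / (real p powr 1 * real p powr (1 / 2)))"
            using pp by (simp add: powr_half_sqrt)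
          also have "real p powr (1 / 4) / (real p powr 1 * real p powr (1 / 2)) = real p powr (-5 / 4)"
            by (simp only: powr_add[symmetric] powr_diff[symmetric]) simp
          finally show "g p / sqrt (real p) \<le> 6 * C0 * real p powr (-5 / 4)" .
        qed simp
        finally show ?thesis by (simp add: mult_ac)
      qed
      have "(\<Sum>a=1..A. \<Sum>b\<in>{a<..A}. \<Sum>p\<in>?P. if p dvd b ^ b - a ^ a then g p else 0)
        = (\<Sum>a=1..A. \<Sum>p\<in>?P. \<Sum>b\<in>{a<..A}. if p dvd b ^ b - a ^ a then g p else 0)"
        by (intro sum.cong refl sum.swap)
      also have "\<dots> = (\<Sum>p\<in>?P. \<Sum>a=1..A. \<Sum>b\<in>{a<..A}. if p dvd b ^ b - a ^ a then g p else 0)"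
        by (rule sum.swap)
      also have "\<dots> \<le> (\<Sum>p\<in>?P. 30 * C0 * (real A)\<^sup>2 * real p powr (-5 / 4))"
        by (intro sum_mono inner)
      also have "\<dots> = 30 * C0 * (real A)\<^sup>2 * (\<Sum>p\<in>?P. real p powr (-5 / 4))" by (simp add: sum_distrib_left)
      also have "\<dots> \<le> 30 * C0 * (real A)\<^sup>2 * K"
        unfolding K_def using C0 by (intro mult_left_mono sum_le_suminf summ) auto
      finally show "(\<Sum>a=1..A. \<Sum>b\<in>{a<..A}. \<Sum>p\<in>?P. if p dvd b ^ b - a ^ a then g p else 0) \<le> 30 * C0 * K * (real A)\<^sup>2"
        by (simp add: mult_ac)
    qed auto
    also have "\<dots> = C * (real A)\<^sup>2" by (simp add: C_def algebra_simps)
    finally show ?thesis .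
  qed
  ultimately show ?thesis by blast
qed

section \<open>First and second moments\<close>

text \<open>The collisions number the sum of the squares of the fibre sizes, to which Cauchy-Schwarz
  applies.\<close>

lemma card_square_le_collisions:
  assumes "finite R"
  shows "(real (card R))\<^sup>2 \<le> real (card (f ` R)) * real (card {(r, r') \<in> R \<times> R. f r = f r'})"
proof -
  define c where "c y = card {r \<in> R. f r = y}" for y
  have 1: "real (card R) = (\<Sum>y\<in>f ` R. real (c y))"
    using sum.image_gen[OF assms, of "\<lambda>_. 1::real" f] by (simp add: c_def)
  have "{(r, r') \<in> R \<times> R. f r = f r'} = Sigma R (\<lambda>r. {r' \<in> R. f r' = f r})" by auto
  then have "card {(r, r') \<in> R \<times> R. f r = f r'} = (\<Sum>r\<in>R. c (f r))"
    using assms by (simp only:) (simp add: c_def)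
  then have "real (card {(r, r') \<in> R \<times> R. f r = f r'}) = (\<Sum>r\<in>R. real (c (f r)))" by simp
  also have "\<dots> = (\<Sum>y\<in>f ` R. \<Sum>r\<in>{r \<in> R. f r = y}. real (c (f r)))"
    by (rule sum.image_gen[OF assms])
  also have "\<dots> = (\<Sum>y\<in>f ` R. (real (c y))\<^sup>2)"
  proof (rule sum.cong)
    fix y
    have "(\<Sum>r\<in>{r \<in> R. f r = y}. real (c (f r))) = (\<Sum>r\<in>{r \<in> R. f r = y}. real (c y))"
      by (intro sum.cong) auto
    then show "(\<Sum>r\<in>{r \<in> R. f r = y}. real (c (f r))) = (real (c y))\<^sup>2"
      by (simp add: c_def power2_eq_square)
  qed simp
  finally have 2: "real (card {(r, r') \<in> R \<times> R. f r = f r'}) = (\<Sum>y\<in>f ` R. (real (c y))\<^sup>2)" .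
  have "(\<Sum>y\<in>f ` R. 1 * real (c y))\<^sup>2 \<le> (\<Sum>y\<in>f ` R. 1\<^sup>2) * (\<Sum>y\<in>f ` R. (real (c y))\<^sup>2)"
    by (rule Cauchy_Schwarz_ineq_sum)
  then show ?thesis using 1 2 by simp
qed

lemma ex_nat_bracket:
  fixes f :: "nat \<Rightarrow> nat"
  assumes "f k \<le> m" "\<And>n. n \<le> f n"
  obtains n where "n \<ge> k" "f n \<le> m" "m < f (Suc n)"
proof -
  let ?S = "{n. n \<ge> k \<and> f n \<le> m}"
  have fin: "finite ?S"
  proof (rule finite_subset)
    show "?S \<subseteq> {..m}"
    proof
      fix n assume "n \<in> ?S"
      then show "n \<in> {..m}" using assms(2)[of n] by simp
    qed
  qed simp
  have M: "Max ?S \<in> ?S" using assms(1) by (intro Max_in fin) auto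
  moreover have "m < f (Suc (Max ?S))"
  proof (rule ccontr)
    assume "\<not> m < f (Suc (Max ?S))"
    then have "Suc (Max ?S) \<in> ?S" using M by simp
    then have "Suc (Max ?S) \<le> Max ?S" using fin by (intro Max_ge) auto
    then show False by simp
  qed
  ultimately show ?thesis using that[of "Max ?S"] by blast
qed

section \<open>Representations and their collisions\<close>

text \<open>The product gets half of the range because \<open>A ^ A\<close> takes the other half,
  which keeps the represented number at most \<open>N\<close>.\<close>

definition representations :: "nat \<Rightarrow> nat \<Rightarrow> nat \<Rightarrow> (nat \<times> nat \<times> nat) set" where
  "representations N z A = {(p, q, a). prime p \<and> p \<le> z \<and> prime q \<and> z < q \<and> p * q \<le> N div 2 \<and> 1 \<le> a \<and> a \<le> A}"

definition represented :: "nat \<times> nat \<times> nat \<Rightarrow> nat" where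
  "represented = (\<lambda>(p, q, a). p * q + a ^ a)"

lemma finite_representations: "finite (representations N z A)"
proof (rule finite_subset)
  show "representations N z A \<subseteq> {..z} \<times> {..N} \<times> {..A}"
  proof clarify
    fix p q a assume r: "(p, q, a) \<in> representations N z A"
    then have "prime p" "p * q \<le> N div 2" by (auto simp: representations_def)
    moreover have "q \<le> p * q" using prime_gt_0_nat[OF \<open>prime p\<close>] by simp
    ultimately have "q \<le> N" by linarith
    then show "p \<in> {..z} \<and> (q, a) \<in> {..N} \<times> {..A}" using r by (auto simp: representations_def)
  qed
qed simp

lemma finite_weighted_prime_pairs:
  assumes "p > 0" "p' > 0"
  shows "finite (weighted_prime_pairs N z h p p')"
proof (rule finite_subset)
  show "weighted_prime_pairs N z h p p' \<subseteq> {..N} \<times> {..N}"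
  proof clarify
    fix q q' assume w: "(q, q') \<in> weighted_prime_pairs N z h p p'"
    have "q \<le> p * q" "q' \<le> p' * q'" using assms by auto
    moreover have "p * q = p' * q' + h" "p * q \<le> N" using w by (auto simp: weighted_prime_pairs_def)
    ultimately have "q \<le> N" "q' \<le> N" by linarith+
    then show "q \<in> {..N} \<and> q' \<in> {..N}" by simp
  qed
qed simp

text \<open>Equal exponents force equal products, and then equal triples, since \<open>q\<close> is
  the prime factor above \<open>z\<close>. All other collisions are counted with the smaller
  exponent first, which explains the factor 2.\<close>

lemma card_collisions_le:
  fixes N z A :: nat
  assumes "A ^ A \<le> N"
  defines "R \<equiv> representations N z A" and "P \<equiv> {p. prime p \<and> p \<le> z}"
  shows "card {(r, r') \<in> R \<times> R. represented r = represented r'} \<le> card R +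
    2 * (\<Sum>a=1..A. \<Sum>b\<in>{a<..A}. \<Sum>p\<in>P. \<Sum>p'\<in>P. card (weighted_prime_pairs N z (b ^ b - a ^ a) p p'))"
proof -
  let ?E = "{(r, r') \<in> R \<times> R. represented r = represented r'}"
  define E1 where "E1 = {(r, r') \<in> ?E. snd (snd r) < snd (snd r')}"
  define W where "W = (\<lambda>((a, b), (p, p')). weighted_prime_pairs N z (b ^ b - a ^ a) p p')"
  define I where "I = Sigma {1..A} (\<lambda>a. {a<..A}) \<times> (P \<times> P)"
  have finR: "finite R" unfolding R_def by (rule finite_representations)
  have finE1: "finite E1" unfolding E1_def by (rule finite_subset[of _ "R \<times> R"]) (use finR in auto)
  have finI: "finite I" unfolding I_def P_def by auto
  have finW: "finite (W i)" if "i \<in> I" for i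
    using that by (auto simp: I_def W_def P_def prime_gt_0_nat intro!: finite_weighted_prime_pairs)
  have eq: "r = r'" if rr: "(r, r') \<in> ?E" "snd (snd r) = snd (snd r')" for r r'
  proof -
    obtain p q a where r: "r = (p, q, a)" by (cases r)
    obtain p' q' a' where r': "r' = (p', q', a')" by (cases r')
    have e: "p * q = p' * q'" using rr by (auto simp: r r' represented_def)
    have pr: "prime p" "prime q" "prime p'" "prime q'" "z < q" "p' \<le> z"
      using rr by (auto simp: r r' R_def representations_def)
    have "q dvd p' * q'" using e by (metis dvd_triv_right)
    then have "q dvd p' \<or> q dvd q'" using pr by (simp add: prime_dvd_mult_iff)
    moreover have "\<not> q dvd p'" using pr primes_dvd_imp_eq[of q p'] by auto
    ultimately have "q = q'" using pr primes_dvd_imp_eq[of q q'] by auto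
    then show ?thesis using e rr pr by (auto simp: r r')
  qed
  have sub: "?E \<subseteq> (\<lambda>r. (r, r)) ` R \<union> E1 \<union> prod.swap ` E1"
  proof
    fix x assume x: "x \<in> ?E"
    obtain r r' where rr: "x = (r, r')" by (cases x)
    consider "snd (snd r) = snd (snd r')" | "snd (snd r) < snd (snd r')" | "snd (snd r') < snd (snd r)" by linarith
    then show "x \<in> (\<lambda>r. (r, r)) ` R \<union> E1 \<union> prod.swap ` E1"
    proof cases
      case 1
      then have "r = r'" using eq x rr by blast
      then show ?thesis using x rr by auto
    next
      case 2
      then show ?thesis using x rr by (auto simp: E1_def)
    next
      case 3
      then have "(r', r) \<in> E1" using x rr by (auto simp: E1_def)
      then have "prod.swap (r', r) \<in> prod.swap ` E1" by (rule imageI)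
      then show ?thesis unfolding rr by simp
    qed
  qed
  have "card ?E \<le> card ((\<lambda>r. (r, r)) ` R \<union> E1 \<union> prod.swap ` E1)"
    using finR finE1 by (intro card_mono sub) auto
  also have "\<dots> \<le> card ((\<lambda>r. (r, r)) ` R) + card E1 + card (prod.swap ` E1)"
    using card_Un_le[of "(\<lambda>r. (r, r)) ` R \<union> E1" "prod.swap ` E1"] card_Un_le[of "(\<lambda>r. (r, r)) ` R" E1]
    by linarith
  also have "\<dots> \<le> card R + card E1 + card E1"
    using finR finE1 by (intro add_mono card_image_le) auto
  also have "card E1 \<le> card (Sigma I W)"
  proof (rule card_inj_on_le)
    let ?g = "\<lambda>(r, r'). (((snd (snd r), snd (snd r')), (fst r, fst r')), (fst (snd r), fst (snd r'))) :: ((nat \<times> nat) \<times> (nat \<times> nat)) \<times> (nat \<times> nat)"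
    show "inj_on ?g E1" by (rule inj_onI) (auto simp: prod_eq_iff)
    show "?g ` E1 \<subseteq> Sigma I W"
    proof (rule image_subsetI)
      fix x assume x: "x \<in> E1"
      obtain p q a p' q' a' where rr: "x = ((p, q, a), (p', q', a'))" by (metis prod_cases3 surj_pair)
      have a: "1 \<le> a" "a < a'" "a' \<le> A" and pr: "prime p" "p \<le> z" "prime q" "z < q" "prime p'" "p' \<le> z" "prime q'" "z < q'"
        and N: "p * q \<le> N div 2" and e: "p * q + a ^ a = p' * q' + a' ^ a'"
        using x by (auto simp: rr E1_def R_def representations_def represented_def)
      have "a ^ a \<le> a' ^ a" using a by (intro power_mono) auto
      also have "\<dots> \<le> a' ^ a'" using a by (intro power_increasing) auto
      finally have "p * q = p' * q' + (a' ^ a' - a ^ a)" using e by linarith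
      moreover have "p * q \<le> N" using N by linarith
      ultimately have "(q, q') \<in> W ((a, a'), (p, p'))" using pr by (simp add: W_def weighted_prime_pairs_def)
      moreover have "((a, a'), (p, p')) \<in> I" using a pr by (simp add: I_def P_def)
      ultimately show "?g x \<in> Sigma I W" by (simp add: rr)
    qed
    show "finite (Sigma I W)" using finI finW by (rule finite_SigmaI)
  qed
  also have "card (Sigma I W) = (\<Sum>i\<in>I. card (W i))" using finI finW by (simp add: card_SigmaI)
  also have "\<dots> = (\<Sum>(a, b)\<in>Sigma {1..A} (\<lambda>a. {a<..A}). \<Sum>(p, p')\<in>P \<times> P. card (weighted_prime_pairs N z (b ^ b - a ^ a) p p'))"
    unfolding I_def by (simp add: W_def case_prod_unfold sum.cartesian_product)
  also have "\<dots> = (\<Sum>a=1..A. \<Sum>b\<in>{a<..A}. \<Sum>p\<in>P. \<Sum>p'\<in>P. card (weighted_prime_pairs N z (b ^ b - a ^ a) p p'))"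
    by (subst sum.Sigma[symmetric]) (auto simp: sum.cartesian_product)
  finally show ?thesis by simp
qed

section \<open>Bounds entering the two moments\<close>

text \<open>Chebyshev's bound up to \<open>2 * n\<close>, about N / (2 p), yields at least N / (16 p
  ln N) primes. Discarding those up to \<open>z\<close> costs at most half of this.\<close>

lemma card_primes_between_ge:
  assumes "prime p" "p \<le> z" "z \<ge> 4" "z ^ 8 \<le> N" "N < (z + 1) ^ 8"
  shows "real N / (32 * real p * ln (real N)) \<le> real (card {q. prime q \<and> z < q \<and> p * q \<le> N div 2})"
proof -
  let ?Q = "{q. prime q \<and> z < q \<and> p * q \<le> N div 2}"
  have p: "p > 0" using prime_gt_0_nat[OF assms(1)] .
  define n where "n = N div 2 div p div 2"
  have z8: "real z ^ 8 \<le> real N" using assms(4) by (simp flip: of_nat_power)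
  have "real p * 16 \<le> real z * real z ^ 7"
  proof (intro mult_mono)
    have "(4::real) ^ 2 \<le> real z ^ 2" using assms(3) by (intro power_mono) auto
    also have "\<dots> \<le> real z ^ 7" using assms(3) by (intro power_increasing) auto
    finally show "16 \<le> real z ^ 7" by simp
  qed (use assms in auto)
  also have "\<dots> = real z ^ 8" by (simp add: eval_nat_numeral)
  also note z8
  finally have Np: "16 \<le> real N / real p" using p by (simp add: field_simps)
  have "n = N div (4 * p)" unfolding n_def by (simp add: div_mult2_eq[symmetric] mult.commute)
  then have "N < 4 * p + n * (4 * p)" using dividend_less_div_times[of "4 * p" N] p by simp
  then have "real N < real (4 * p + n * (4 * p))" by (simp only: of_nat_less_iff)
  then have "real n > real N / (4 * real p) - 1" using p by (simp add: field_simps)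
  then have nN: "real n \<ge> real N / (8 * real p)" using Np by simp
  then have n1: "n \<ge> 1" using Np by (cases n) auto
  have npN: "p * (2 * n) \<le> N div 2"
  proof -
    have "n * 2 \<le> N div 2 div p" unfolding n_def by simp
    then have "n * 2 * p \<le> N div 2" using p by (simp add: less_eq_div_iff_mult_less_eq)
    then show ?thesis by (simp add: mult_ac)
  qed
  have "2 * n \<le> p * (2 * n)" using p by simp
  then have n2N: "2 * n \<le> N" using npN by linarith
  have fin: "finite ?Q"
  proof (rule finite_subset)
    show "?Q \<subseteq> {..N}"
    proof
      fix q assume "q \<in> ?Q"
      then have "p * q \<le> N div 2" by simp
      moreover have "q \<le> p * q" using p by simp
      ultimately have "q \<le> N" by linarith
      then show "q \<in> {..N}" by simp
    qed
  qed simp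
  have "{q. prime q \<and> q \<le> 2 * n} \<subseteq> {1..z} \<union> ?Q"
  proof
    fix q assume q: "q \<in> {q. prime q \<and> q \<le> 2 * n}"
    then have "p * q \<le> p * (2 * n)" by simp
    then have "p * q \<le> N div 2" using npN by linarith
    then show "q \<in> {1..z} \<union> ?Q" using q by (auto simp: Suc_le_eq prime_gt_0_nat)
  qed
  then have "card {q. prime q \<and> q \<le> 2 * n} \<le> card ({1..z} \<union> ?Q)" using fin by (intro card_mono) auto
  also have "\<dots> \<le> z + card ?Q" using card_Un_le[of "{1..z}" ?Q] by simp
  finally have c: "real (card {q. prime q \<and> q \<le> 2 * n}) \<le> real z + real (card ?Q)"
    by (simp only: of_nat_add[symmetric] of_nat_le_iff)
  have "real N \<ge> 2" using n2N n1 by linarith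
  then have lnN: "ln (real N) > 0" by simp
  have "real N / (16 * real p) \<le> real n * (1 / 2)" using nN by simp
  also have "\<dots> \<le> real n * ln 2" using ln2_ge_two_thirds by (intro mult_left_mono) auto
  also have "\<dots> \<le> real (card {q. prime q \<and> q \<le> 2 * n}) * ln (2 * real n)"
    by (rule card_primes_ge[OF n1])
  also have "\<dots> \<le> (real z + real (card ?Q)) * ln (real N)"
  proof (rule mult_mono[OF c])
    have "real (2 * n) \<le> real N" using n2N by (simp only: of_nat_le_iff)
    then show "ln (2 * real n) \<le> ln (real N)" using n1 by (subst ln_le_cancel_iff) auto
  qed (use n1 in auto)
  finally have 1: "real N / (16 * real p) / ln (real N) \<le> real z + real (card ?Q)"
    using lnN by (simp only: pos_divide_le_eq)
  \<comment> \<open>With \<open>ln (real N)\<close> at most 8 z the claim reduces to 256 z^3 being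
    at most \<open>N\<close>; as 256 = 4^4 and \<open>z\<close> is at least 4, the left side is at
    most z^7.\<close>
  have 2: "real z \<le> real N / (32 * real p) / ln (real N)"
  proof -
    have "real N \<le> real ((z + 1) ^ 8)" using assms(5) by (intro of_nat_mono less_imp_le)
    then have "ln (real N) \<le> ln ((real z + 1) ^ 8)"
      using \<open>real N \<ge> 2\<close> by (subst ln_le_cancel_iff) (auto simp: add.commute)
    also have "\<dots> = 8 * ln (1 + real z)" by (simp add: ln_realpow add.commute)
    also have "\<dots> \<le> 8 * real z" using ln_add_one_self_le_self[of "real z"] by simp
    finally have "real z * (32 * real p) * ln (real N) \<le> real z * (32 * real z) * (8 * real z)"
      using assms(2) lnN by (intro mult_mono) auto
    also have "\<dots> = real z ^ 3 * 4 ^ 4" by (simp add: eval_nat_numeral)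
    also have "\<dots> \<le> real z ^ 3 * real z ^ 4" using assms(3) by (intro mult_left_mono power_mono) auto
    also have "\<dots> = real z ^ 7" by (simp flip: power_add)
    also have "\<dots> \<le> real z ^ 8" using assms(3) by (intro power_increasing) auto
    also have "\<dots> \<le> real N" by (rule z8)
    finally show ?thesis using p lnN by (simp add: field_simps)
  qed
  have "real N / (16 * real p) / ln (real N) = 2 * (real N / (32 * real p) / ln (real N))" by simp
  then show ?thesis using 1 2 by (simp add: mult.assoc)
qed

lemma card_representations_ge:
  assumes "z \<ge> 4" "z ^ 8 \<le> N" "N < (z + 1) ^ 8"
  shows "real A * (\<Sum>p | prime p \<and> p \<le> z. 1 / real p) * (real N / (32 * ln (real N)))
    \<le> real (card (representations N z A))"
proof -
  let ?P = "{p. prime p \<and> p \<le> z}"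
  let ?Q = "\<lambda>p. {q. prime q \<and> z < q \<and> p * q \<le> N div 2}"
  have finQ: "finite (?Q p)" if "p \<in> ?P" for p
  proof (rule finite_subset)
    show "?Q p \<subseteq> {..N}"
    proof
      fix q assume "q \<in> ?Q p"
      then have "p * q \<le> N div 2" by simp
      moreover have "p > 0" using that by (auto intro: prime_gt_0_nat)
      then have "q \<le> p * q" by simp
      ultimately have "q \<le> N" by linarith
      then show "q \<in> {..N}" by simp
    qed
  qed simp
  have "representations N z A = (\<lambda>((p, q), a). (p, q, a)) ` (Sigma ?P ?Q \<times> {1..A})"
    by (auto simp: representations_def image_iff)
  moreover have "inj_on (\<lambda>((p, q), a). (p, q, a)) (Sigma ?P ?Q \<times> {1..A})" by (auto simp: inj_on_def)
  ultimately have "card (representations N z A) = card (Sigma ?P ?Q) * A"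
    by (simp add: card_image card_cartesian_product)
  also have "card (Sigma ?P ?Q) = (\<Sum>p\<in>?P. card (?Q p))" using finQ by (intro card_SigmaI) auto
  finally have "real (card (representations N z A)) = real A * (\<Sum>p\<in>?P. real (card (?Q p)))"
    by (simp add: mult.commute)
  moreover have "(\<Sum>p\<in>?P. real N / (32 * real p * ln (real N))) \<le> (\<Sum>p\<in>?P. real (card (?Q p)))"
    by (intro sum_mono card_primes_between_ge assms) auto
  moreover have "(\<Sum>p\<in>?P. real N / (32 * real p * ln (real N))) = (\<Sum>p\<in>?P. 1 / real p) * (real N / (32 * ln (real N)))"
    unfolding sum_distrib_right by (intro sum.cong) (auto simp: mult_ac)
  ultimately have "real A * ((\<Sum>p\<in>?P. 1 / real p) * (real N / (32 * ln (real N)))) \<le> real (card (representations N z A))"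
    by (simp only: mult_left_mono of_nat_0_le_iff)
  then show ?thesis by (simp only: mult.assoc)
qed

lemma sum_card_weighted_prime_pairs_le:
  assumes "h > 0" "z \<ge> 2" "z ^ 8 \<le> N" "v\<^sup>2 \<le> z"
  defines "P \<equiv> {p. prime p \<and> p \<le> z}" and "L \<equiv> \<Sum>p | prime p \<and> p \<le> z. 1 / real p"
  shows "(\<Sum>p\<in>P. \<Sum>p'\<in>P. real (card (weighted_prime_pairs N z h p p'))) * (harm v)\<^sup>2
    \<le> 600 * real N * L\<^sup>2 * singular_product v h"
proof -
  let ?S = "singular_product v h"
  have fin: "finite P" by (simp add: P_def)
  have S0: "?S \<ge> 0" using singular_product_ge_1[of v h] by simp
  have "2 \<in> P" using assms by (simp add: P_def)
  \<comment> \<open>The prime 2 alone gives this. It absorbs the diagonal, L^2 + L being at most 3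
    L^2, so 200 becomes 600.\<close>
  then have L: "L \<ge> 1 / 2" unfolding L_def P_def[symmetric]
    using member_le_sum[of 2 P "\<lambda>p. 1 / real p"] fin by auto
  have "(\<Sum>p\<in>P. \<Sum>p'\<in>P. real (card (weighted_prime_pairs N z h p p'))) * (harm v)\<^sup>2
    = (\<Sum>p\<in>P. \<Sum>p'\<in>P. real (card (weighted_prime_pairs N z h p p')) * (harm v)\<^sup>2)"
    by (simp add: sum_distrib_right)
  also have "\<dots> \<le> (\<Sum>p\<in>P. \<Sum>p'\<in>P. (200 * real N * ?S) * (1 / real p * (1 / real p') + (if p = p' then 1 / real p else 0)))"
  proof (intro sum_mono)
    fix p p' assume pp: "p \<in> P" "p' \<in> P"
    show "real (card (weighted_prime_pairs N z h p p')) * (harm v)\<^sup>2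
      \<le> (200 * real N * ?S) * (1 / real p * (1 / real p') + (if p = p' then 1 / real p else 0))"
    proof (cases "p = p'")
      case True
      have "real (card (weighted_prime_pairs N z h p p)) * (harm v)\<^sup>2 \<le> 200 * (real N / real p) * ?S"
        using pp assms by (intro card_weighted_prime_pairs_same) (auto simp: P_def)
      also have "\<dots> = (200 * real N * ?S) * (1 / real p)" by simp
      also have "\<dots> \<le> (200 * real N * ?S) * (1 / real p * (1 / real p) + 1 / real p)"
        using S0 by (intro mult_left_mono) auto
      finally show ?thesis using True by (simp only: simp_thms if_True)
    next
      case False
      have "real (card (weighted_prime_pairs N z h p p')) * (harm v)\<^sup>2 \<le> 200 * (real N / (real p * real p')) * ?S"
        using pp assms False by (intro card_weighted_prime_pairs_distinct) (auto simp: P_def)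
      then show ?thesis using False by simp
    qed
  qed
  also have "\<dots> = (200 * real N * ?S) * (\<Sum>p\<in>P. \<Sum>p'\<in>P. 1 / real p * (1 / real p') + (if p = p' then 1 / real p else 0))"
    by (simp only: sum_distrib_left)
  also have "(\<Sum>p\<in>P. \<Sum>p'\<in>P. 1 / real p * (1 / real p') + (if p = p' then 1 / real p else 0)) = L\<^sup>2 + L"
    unfolding L_def P_def[symmetric] power2_eq_square sum_product sum.distrib using fin by simp
  also have "(200 * real N * ?S) * (L\<^sup>2 + L) \<le> (200 * real N * ?S) * (3 * L\<^sup>2)"
  proof (rule mult_left_mono)
    have "L * (1 / 2) \<le> L * L" using L by (intro mult_left_mono) auto
    then show "L\<^sup>2 + L \<le> 3 * L\<^sup>2" by (simp add: power2_eq_square)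
  qed (use S0 in auto)
  finally show ?thesis by (simp add: mult_ac)
qed

text \<open>The two double logarithms cancel: \<open>A\<close> is at least a constant times l / ln
  l, and the sum over primes is at least ln l / 4, where \<open>l\<close> is ln N.\<close>

lemma exponents_times_prime_sum_ge:
  assumes N: "exp (exp 8) \<le> real N" and z: "N < (z + 1) ^ 8" "z \<ge> 1"
    and A: "A \<ge> 3" "A ^ A \<le> N div 2" "N div 2 < Suc A ^ Suc A"
  shows "ln (real N) / 32 \<le> real A * (\<Sum>p | prime p \<and> p \<le> z. 1 / real p)"
proof -
  define l where "l = ln (real N)"
  define L where "L = (\<Sum>p | prime p \<and> p \<le> z. 1 / real p)"
  have N0: "real N > 0" using N exp_gt_zero[of "exp 8"] by linarith
  have "ln (exp (exp 8)) \<le> l" unfolding l_def using N N0 by (subst ln_le_cancel_iff) auto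
  then have l: "exp 8 \<le> l" by simp
  then have l9: "l \<ge> 9" using exp_ge_add_one_self[of 8] by linarith
  have "ln (exp 8) \<le> ln l" using l l9 by (subst ln_le_cancel_iff) auto
  then have ll: "ln l \<ge> 8" by simp
  have ln2: "ln 2 \<le> (1::real)" using ln_le_minus_one[of "2::real"] by simp
  have ln8: "ln (8::real) = 3 * ln 2" using ln_realpow[of "2::real" 3] by simp
  \<comment> \<open>Passing from \<open>N\<close> to \<open>z\<close> loses \<open>ln 8\<close>, at
    most 3, in the double logarithm. The threshold exp (exp 8) makes \<open>ln l\<close> at least 8
    and absorbs the loss.\<close>
  have L: "L \<ge> ln l / 4"
  proof -
    have "real N \<le> real ((z + 1) ^ 8)" using z(1) by (intro of_nat_mono less_imp_le)
    then have "l \<le> ln ((real z + 1) ^ 8)"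
      unfolding l_def using N0 by (subst ln_le_cancel_iff) (auto simp: add.commute)
    then have "l / 8 \<le> ln (real z + 1)" by (simp add: ln_realpow)
    then have "ln (l / 8) \<le> ln (ln (real z + 1))" using l9 z(2) by (subst ln_le_cancel_iff) auto
    also have "\<dots> \<le> 2 * L" unfolding L_def by (rule ln_ln_le_sum_inverse_primes[OF z(2)])
    finally have "ln l - ln 8 \<le> 2 * L" using l9 by (simp add: ln_div)
    then show ?thesis using ln2 ln8 ll by linarith
  qed
  have lnA: "ln (real A) \<ge> 1"
  proof -
    have "exp 1 \<le> real A" using A(1) exp_le by linarith
    then have "ln (exp 1) \<le> ln (real A)" by (subst ln_le_cancel_iff) (use A in auto)
    then show ?thesis by simp
  qed
  have "A ^ A \<le> N" using A(2) by linarith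
  then have "real (A ^ A) \<le> real N" by (simp only: of_nat_le_iff)
  then have "ln (real A ^ A) \<le> l" unfolding l_def using A N0 by (subst ln_le_cancel_iff) auto
  then have "real A * ln (real A) \<le> l" using A by (simp add: ln_realpow)
  moreover have "real A * 1 \<le> real A * ln (real A)" using lnA by (intro mult_left_mono) auto
  \<comment> \<open>A crude bound suffices inside a logarithm: it gives ln (A + 1) <= 2 ln l, and
    the maximality of \<open>A\<close> then bounds \<open>A\<close> from below.\<close>
  ultimately have "real A \<le> l" by simp
  then have "real (Suc A) \<le> 2 * l" using l9 by simp
  then have "ln (real (Suc A)) \<le> ln (2 * l)" using l9 by (subst ln_le_cancel_iff) auto
  then have lnSA: "ln (real (Suc A)) \<le> 2 * ln l" using l9 ln2 ll by (simp add: ln_mult)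
  have "N < 2 * Suc A ^ Suc A" using A(3) by linarith
  then have "real N \<le> real (2 * Suc A ^ Suc A)" by (intro of_nat_mono less_imp_le)
  then have "l \<le> ln (2 * real (Suc A) ^ Suc A)"
    unfolding l_def using N0 by (subst ln_le_cancel_iff) (auto simp del: power_Suc)
  also have "\<dots> = ln 2 + real (Suc A) * ln (real (Suc A))" by (simp add: ln_mult ln_realpow del: power_Suc of_nat_Suc)
  also have "\<dots> \<le> 1 + (2 * real A) * (2 * ln l)"
    using ln2 lnSA A by (intro add_mono mult_mono) auto
  also have "\<dots> = 1 + 4 * (real A * ln l)" by simp
  finally have "l / 32 \<le> real A * (ln l / 4)" using l9 by simp
  also have "\<dots> \<le> real A * L" using L by (intro mult_left_mono) auto
  finally show ?thesis using l9 unfolding l_def L_def by simp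
qed

lemma prime_times_prime_mem_P2:
  assumes "prime p" "prime q"
  shows "p * q \<in> P2"
proof -
  have "p > 0" "q > 0" using assms by (auto intro: prime_gt_0_nat)
  moreover from this have "prime_factorization (p * q) = {#p, q#}"
    using assms by (simp add: prime_factorization_mult prime_factorization_prime)
  ultimately show ?thesis by (simp add: P2_def big_omega_def Suc_le_eq)
qed

theorem theorem1p1:
  shows "\<exists>\<delta>::real. \<delta> > 0 \<and>
    (\<forall>\<^sub>F N::nat in sequentially.
      real (card {n \<in> {1..N}. \<exists>m\<in>P2. \<exists>a::nat. a \<ge> 1 \<and> n = m + a ^ a}) \<ge> \<delta> * real N)"
proof -
  obtain C where C: "C > 0"
    "\<And>A v. A \<ge> 1 \<Longrightarrow> (\<Sum>a=1..A. \<Sum>b\<in>{a<..A}. singular_product v (b ^ b - a ^ a)) \<le> C * (real A)\<^sup>2"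
    using sum_singular_product_self_powers_le by blast
  \<comment> \<open>The first 1024 pays for the diagonal. In the other term 2 comes from ordering
    the exponents, 600 from the sieve, 256 = 16^2 from the bound \<open>l / 16 \<le> harm v\<close>,
    and 1024 = 32^2 from the denominator of the first moment.\<close>
  define D where "D = 1024 + 2 * 600 * 256 * 1024 * C"
  have D: "D > 0" using C(1) by (simp add: D_def)
  have main: "real (card {n \<in> {1..N}. \<exists>m\<in>P2. \<exists>a::nat. a \<ge> 1 \<and> n = m + a ^ a}) \<ge> 1 / D * real N"
    if N: "N \<ge> 4 ^ 8" "exp (exp 8) \<le> real N" for N
  proof -
    define l where "l = ln (real N)"
    have l: "l > 0" using N(1) by (simp add: l_def)
    have pow: "n \<le> n ^ 8" "n \<le> n\<^sup>2" "n \<le> n ^ n" for n :: nat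
      by (cases "n = 0"; simp add: self_le_power)+
    obtain z where z: "z \<ge> 4" "z ^ 8 \<le> N" "N < (Suc z) ^ 8"
      by (rule ex_nat_bracket[of "\<lambda>n. n ^ 8" 4 N]) (use N(1) pow in auto)
    obtain v where v: "v\<^sup>2 \<le> z" "z < (Suc v)\<^sup>2"
      by (rule ex_nat_bracket[of "\<lambda>n. n\<^sup>2" 0 z]) (use pow in auto)
    obtain A where A: "A \<ge> 3" "A ^ A \<le> N div 2" "N div 2 < Suc A ^ Suc A"
      by (rule ex_nat_bracket[of "\<lambda>n. n ^ n" 3 "N div 2"]) (use N(1) pow in auto)
    define L where "L = (\<Sum>p | prime p \<and> p \<le> z. 1 / real p)"
    define R where "R = representations N z A"
    define E where "E = {(r, r') \<in> R \<times> R. represented r = represented r'}"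
    define r where "r = real (card R)"
    have R: "real A * L * (real N / (32 * l)) \<le> r"
      unfolding L_def l_def R_def r_def using z by (intro card_representations_ge) auto
    have AL: "l / 32 \<le> real A * L"
      unfolding L_def l_def using N z A by (intro exponents_times_prime_sum_ge) auto
    have rN: "real N \<le> 1024 * r"
    proof -
      have "real N = 1024 * (l / 32 * (real N / (32 * l)))" using l by simp
      also have "\<dots> \<le> 1024 * (real A * L * (real N / (32 * l)))"
        using AL l by (intro mult_left_mono mult_right_mono) auto
      finally show ?thesis using R by linarith
    qed
    have harm: "l / 16 \<le> harm v"
    proof -
      \<comment> \<open>As \<open>v\<close> is about the square root of \<open>z\<close>, and
        \<open>z\<close> about the eighth root of \<open>N\<close>, the harmonic sum retains a
        sixteenth of \<open>l\<close>.\<close>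
      have "Suc z ^ 8 \<le> ((Suc v)\<^sup>2) ^ 8" using v(2) by (intro power_mono) auto
      also have "\<dots> = Suc v ^ 16" by (simp flip: power_mult del: power_Suc)
      finally have "N \<le> Suc v ^ 16" using z(3) by linarith
      then have "real N \<le> real (Suc v ^ 16)" by (intro of_nat_mono)
      then have "l \<le> ln ((real v + 1) ^ 16)"
        unfolding l_def using N(1) by (subst ln_le_cancel_iff) (auto simp: add.commute)
      also have "\<dots> = 16 * ln (real v + 1)" by (simp add: ln_realpow)
      also have "\<dots> \<le> 16 * harm v" using ln_le_harm[of v] by simp
      finally show ?thesis by simp
    qed
    define W where "W a b = (\<Sum>p | prime p \<and> p \<le> z. \<Sum>p' | prime p' \<and> p' \<le> z.
      real (card (weighted_prime_pairs N z (b ^ b - a ^ a) p p')))" for a b :: nat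
    have W: "W a b \<le> 600 * 256 * real N * (L / l)\<^sup>2 * singular_product v (b ^ b - a ^ a)"
      if ab: "a \<in> {1..A}" "b \<in> {a<..A}" for a b
    proof -
      have "a ^ a < b ^ a" using ab by (intro power_strict_mono) auto
      also have "b ^ a \<le> b ^ b" using ab by (intro power_increasing) auto
      finally have pos: "0 < b ^ b - a ^ a" by simp
      have W0: "W a b \<ge> 0" unfolding W_def by (intro sum_nonneg) auto
      have "W a b * (l / 16)\<^sup>2 \<le> W a b * (harm v)\<^sup>2"
        using W0 harm l by (intro mult_left_mono power_mono) auto
      also have "\<dots> \<le> 600 * real N * L\<^sup>2 * singular_product v (b ^ b - a ^ a)"
        unfolding W_def L_def using z v pos by (intro sum_card_weighted_prime_pairs_le) auto
      finally show ?thesis using l by (simp add: power_divide field_simps)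
    qed
    have E: "real (card E) \<le> D * r\<^sup>2 / real N"
    proof -
      have "A ^ A \<le> N" using A(2) by linarith
      then have "card E \<le> card R + 2 * (\<Sum>a=1..A. \<Sum>b\<in>{a<..A}. \<Sum>p | prime p \<and> p \<le> z. \<Sum>p' | prime p' \<and> p' \<le> z.
          card (weighted_prime_pairs N z (b ^ b - a ^ a) p p'))"
        unfolding E_def R_def by (rule card_collisions_le)
      then have "real (card E) \<le> r + 2 * (\<Sum>a=1..A. \<Sum>b\<in>{a<..A}. W a b)"
        unfolding r_def W_def by (simp flip: of_nat_sum)
      also have "(\<Sum>a=1..A. \<Sum>b\<in>{a<..A}. W a b)
        \<le> (\<Sum>a=1..A. \<Sum>b\<in>{a<..A}. 600 * 256 * real N * (L / l)\<^sup>2 * singular_product v (b ^ b - a ^ a))"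
        by (intro sum_mono W)
      also have "\<dots> = 600 * 256 * real N * (L / l)\<^sup>2 * (\<Sum>a=1..A. \<Sum>b\<in>{a<..A}. singular_product v (b ^ b - a ^ a))"
        by (simp only: sum_distrib_left)
      also have "\<dots> \<le> 600 * 256 * real N * (L / l)\<^sup>2 * (C * (real A)\<^sup>2)"
        using C(2)[of A v] A(1) by (intro mult_left_mono) auto
      \<comment> \<open>The second moment is expressed through the same quantity that bounds
        \<open>r\<close> from below, so it can be compared with r^2 / N directly and no upper bound
        for \<open>r\<close> is required.\<close>
      also have "\<dots> = 600 * 256 * 1024 * C * ((real A * L * (real N / (32 * l)))\<^sup>2 / real N)"
        using N(1) l by (simp add: power2_eq_square field_simps)
      also have "\<dots> \<le> 600 * 256 * 1024 * C * (r\<^sup>2 / real N)"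
      proof (intro mult_left_mono divide_right_mono power_mono R)
        have "0 \<le> real A * L" using AL l by (meson divide_nonneg_nonneg le_less_trans less_eq_real_def order_trans zero_le_numeral)
        then show "0 \<le> real A * L * (real N / (32 * l))" using l by simp
      qed (use C(1) in auto)
      finally have "real (card E) \<le> r + 2 * (600 * 256 * 1024 * C * (r\<^sup>2 / real N))" by simp
      \<comment> \<open>The diagonal is harmless because there are at least N / 1024
        representations.\<close>
      moreover have "r \<le> 1024 * (r\<^sup>2 / real N)"
        using mult_right_mono[OF rN, of r] N(1) by (simp add: r_def power2_eq_square field_simps)
      ultimately have "real (card E) \<le> 1024 * (r\<^sup>2 / real N) + 2 * (600 * 256 * 1024 * C * (r\<^sup>2 / real N))"
        by linarith
      also have "\<dots> = D * (r\<^sup>2 / real N)" by (simp add: D_def algebra_simps)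
      finally show ?thesis by simp
    qed
    have r0: "r > 0" using rN N(1) by simp
    have "r\<^sup>2 \<le> real (card (represented ` R)) * real (card E)"
      unfolding r_def E_def R_def by (intro card_square_le_collisions finite_representations)
    also have "\<dots> \<le> real (card (represented ` R)) * (D * r\<^sup>2 / real N)"
      using E by (intro mult_left_mono) auto
    also have "\<dots> = (real (card (represented ` R)) * D / real N) * r\<^sup>2" by simp
    finally have "1 * r\<^sup>2 \<le> (real (card (represented ` R)) * D / real N) * r\<^sup>2" by (simp only: mult_1)
    then have "1 \<le> real (card (represented ` R)) * D / real N"
      by (rule mult_right_le_imp_le) (use r0 in simp)
    then have "1 / D * real N \<le> real (card (represented ` R))"
      using D N(1) by (simp add: field_simps)
    also have "represented ` R \<subseteq> {n \<in> {1..N}. \<exists>m\<in>P2. \<exists>a::nat. a \<ge> 1 \<and> n = m + a ^ a}"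
    proof (rule image_subsetI)
      fix x assume x: "x \<in> R"
      obtain p q a where xx: "x = (p, q, a)" by (cases x)
      have pq: "prime p" "prime q" "p * q \<le> N div 2" and a: "1 \<le> a" "a \<le> A"
        using x by (auto simp: xx R_def representations_def)
      have "a ^ a \<le> A ^ a" using a by (intro power_mono) auto
      also have "\<dots> \<le> A ^ A" using a by (intro power_increasing) auto
      finally have "p * q + a ^ a \<le> N" using pq(3) A(2) by linarith
      moreover have "1 \<le> a ^ a" using a by simp
      ultimately have "p * q + a ^ a \<in> {1..N}" by simp
      then show "represented x \<in> {n \<in> {1..N}. \<exists>m\<in>P2. \<exists>a::nat. a \<ge> 1 \<and> n = m + a ^ a}"
        using prime_times_prime_mem_P2[OF pq(1,2)] a(1) by (auto simp: xx represented_def)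
    qed
    then have "real (card (represented ` R)) \<le> real (card {n \<in> {1..N}. \<exists>m\<in>P2. \<exists>a::nat. a \<ge> 1 \<and> n = m + a ^ a})"
      by (intro of_nat_mono card_mono) auto
    finally show ?thesis .
  qed
  have large: "\<forall>\<^sub>F N in sequentially. 4 ^ 8 \<le> N \<and> exp (exp 8) \<le> real N"
    using filterlim_real_sequentially by (intro eventually_conj eventually_ge_at_top) (simp add: filterlim_at_top)
  have "\<forall>\<^sub>F N in sequentially. real (card {n \<in> {1..N}. \<exists>m\<in>P2. \<exists>a::nat. a \<ge> 1 \<and> n = m + a ^ a}) \<ge> 1 / D * real N"
    using large by (rule eventually_mono) (rule main; blast)
  then show ?thesis using D by (intro exI[of _ "1 / D"] conjI) simp_all
qed

end
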